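(* Let $\Omega$ be a (one-dimensional, FLC, minimal) uniquely ergodic tiling space. If $F\in\mathcal F(\Omega)$ has rotation forms $\mu$ and $\nu$, and if $[\mu]$ is irrational, then $\mu$ and $\nu$ are cohomologous.
   Context: Tilings: A tile is a pair $(I,\ell)$, with $I\subset\mathbb R$ a closed bounded interval of positive length and $\ell$ a label from a finite alphabet; tiles with the same label have the same length. $(I,\ell)-s=(I-s,\ell)$. A tiling $T$ is a collection of tiles meeting only at boundaries with union $\mathbb R$; $T-s$ is obtained by translating all tiles, and $\Gamma_s(T)=T-s$. (Such tilings have finite local complexity, FLC.) $d(T,T')$ is the infimum of the $\epsilon\in(0,1)$ for which there are $|s_1|,|s_2|\le\epsilon/2$ with $T-s_1$ and $T'-s_2$ agreeing exactly on $[-\epsilon^{-1},\epsilon^{-1}]$ ($1$ if there is none). $T$ is repetitive if for each finite pattern $P$ of $T$ there is $L_P$ such that every interval of length $L_P$ in $T$ contains a copy of $P$. A tiling space $\Omega$ is the closure of the translation orbit $\{T-s\}$ of a repetitive non-periodic tiling; it is compact, minimal under $\Gamma$, and its path components are the translation orbits. Uniquely ergodic means that $(\Omega,\Gamma)$ has a unique invariant probability measure. The orbit of a reference tiling $T\in\Omega$ is identified with $\mathbb R$ by $T-x\leftrightarrow x$. Pattern equivariance: A continuous $\phi:\mathbb R\to\mathbb R$ is pattern equivariant with radius $R$ with respect to $T$ if $\phi(x_1)=\phi(x_2)$ whenever $T-x_1$ and $T-x_2$ agree exactly on $[-R,R]$; it is strongly pattern equivariant (sPE) if this holds for some $R>0$.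 A continuous $G:\Omega\to\mathbb R$ is sPE if $x\mapsto G(T-x)$ is sPE with respect to $T$ (for one, equivalently every, $T\in\Omega$). An sPE 1-form with respect to $T$ is $g(x)\,dx$ with $g$ sPE. Two sPE 1-forms are cohomologous if they differ by $dg$ with $g$ sPE; $[\mu]$ denotes the class of $\mu$ in $\{\text{sPE 1-forms}\}/d\{\text{sPE functions}\}\cong\check H^1(\Omega,\mathbb R)$. Maps: $\mathcal F(\Omega)$ is the set of homeomorphisms $F:\Omega\to\Omega$, homotopic to the identity, such that the displacement $\Phi:\Omega\to\mathbb R$, defined by $F(T)=T-\Phi(T)$, is sPE. For a reference tiling $T$, $f_T:\mathbb R\to\mathbb R$ is given by $F(T-x)=T-f_T(x)$. Rotation forms: An sPE 1-form $\mu$ (with respect to a reference tiling $T$) is a rotation form for $F$ if there is $R$ such that, for all $x_1,x_2\in\mathbb R$ for which $T-x_1$ and $T-x_2$ agree on the ball of radius $R$ about the origin, and all integers $n_\pm$ with $n_-<\int_{x_1}^{x_2}\mu<n_+$, the point $x_2$ is strictly between $f_T^{n_-}(x_1)$ and $f_T^{n_+}(x_1)$. Any form cohomologous to a rotation form is a rotation form, and $[\mu]$ is then called a rotation class. Shape change and irrationality: Let $\mu$ be a positive sPE 1-form of radius $R$ with respect to $T$. Relabel (collar) the tiles of $T$ so that the label of each tile records the pattern of $T$ around it out to distance $R$; this does not change the space up to translation-commuting homeomorphism. Let $T'$ be obtained by keeping labels and moving each vertex $x$ of $T$ to $\int_0^x\mu$. The orbit closure $\Omega_\mu$ of $T'$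 is the shape change of $\Omega$ by $\mu$, and $T-x\mapsto T'-\int_0^x\mu$ extends to a homeomorphism $S:\Omega\to\Omega_\mu$. Shape changes by negative forms are defined similarly (and reverse orientation). A class is irrational if it is represented by a positive (or negative) sPE 1-form $\mu$ such that $\Omega_\mu$ is minimal under the action of $\Gamma_1$ (translation by $1$); this does not depend on the choice of representative. *)

theory Defs
  imports "HOL-Analysis.Analysis" "HOL-Probability.Probability_Measure"
begin

section \<open>Tilings of the line\<close>

type_synonym 'l tile = "real set \<times> 'l"

definition tile_length :: "'l tile \<Rightarrow> real" where
  "tile_length t = Sup (fst t) - Inf (fst t)"

text \<open>The alphabet is the set of labels that occur; the type \<open>'l\<close> itself need not be finite.\<close>

definition tiling :: "'l tile set \<Rightarrow> bool" where
  "tiling T \<longleftrightarrow>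
     (\<forall>t\<in>T. \<exists>a b. a < b \<and> fst t = {a..b}) \<and>
     finite (snd ` T) \<and>
     (\<forall>t\<in>T. \<forall>u\<in>T. snd t = snd u \<longrightarrow> tile_length t = tile_length u) \<and>
     (\<forall>t\<in>T. \<forall>u\<in>T. t \<noteq> u \<longrightarrow> interior (fst t) \<inter> interior (fst u) = {}) \<and>
     (\<Union>t\<in>T. fst t) = UNIV"

definition shift_tile :: "real \<Rightarrow> 'l tile \<Rightarrow> 'l tile" where
  "shift_tile s t = ((\<lambda>x. x - s) ` fst t, snd t)"

definition shift :: "real \<Rightarrow> 'l tile set \<Rightarrow> 'l tile set" where
  "shift s T = shift_tile s ` T"

definition patch :: "real set \<Rightarrow> 'l tile set \<Rightarrow> 'l tile set" where
  "patch A T = {t \<in> T. fst t \<inter> A \<noteq> {}}"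

definition agree_on :: "real set \<Rightarrow> 'l tile set \<Rightarrow> 'l tile set \<Rightarrow> bool" where
  "agree_on A T T' \<longleftrightarrow> patch A T = patch A T'"

definition tilings_close :: "real \<Rightarrow> 'l tile set \<Rightarrow> 'l tile set \<Rightarrow> bool" where
  "tilings_close \<epsilon> T T' \<longleftrightarrow>
     (\<exists>s1 s2. \<bar>s1\<bar> \<le> \<epsilon> / 2 \<and> \<bar>s2\<bar> \<le> \<epsilon> / 2 \<and>
        agree_on {- (1 / \<epsilon>)..1 / \<epsilon>} (shift s1 T) (shift s2 T'))"

text \<open>Inserting \<open>1\<close> gives the value \<open>1\<close> when no \<open>\<epsilon>\<close> qualifies, and changes nothing otherwise.\<close>

definition tiling_dist :: "'l tile set \<Rightarrow> 'l tile set \<Rightarrow> real" where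
  "tiling_dist T T' = Inf (insert 1 {\<epsilon>. 0 < \<epsilon> \<and> \<epsilon> < 1 \<and> tilings_close \<epsilon> T T'})"

lemma shift_tile_shift_tile: "shift_tile a (shift_tile b t) = shift_tile (a + b) t"
  by (auto simp: shift_tile_def image_image algebra_simps)

lemma shift_tile_0 [simp]: "shift_tile 0 t = t"
  by (simp add: shift_tile_def)

lemma shift_shift: "shift a (shift b T) = shift (a + b) T"
  by (simp add: shift_def image_image shift_tile_shift_tile)

lemma shift_0 [simp]: "shift 0 T = T"
  by (simp add: shift_def)

lemma mem_shift_iff: "t \<in> shift s T \<longleftrightarrow> shift_tile (- s) t \<in> T"
proof
  assume "t \<in> shift s T"
  then show "shift_tile (- s) t \<in> T"
    by (auto simp: shift_def shift_tile_shift_tile)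
next
  assume "shift_tile (- s) t \<in> T"
  then have "shift_tile s (shift_tile (- s) t) \<in> shift s T"
    unfolding shift_def by blast
  then show "t \<in> shift s T" by (simp add: shift_tile_shift_tile)
qed

lemma patch_shift: "patch ((\<lambda>x. x - s) ` A) (shift s T) = shift s (patch A T)"
proof -
  have "fst (shift_tile s t) \<inter> (\<lambda>x. x - s) ` A \<noteq> {} \<longleftrightarrow> fst t \<inter> A \<noteq> {}" for t :: "'a tile"
    by (auto simp: shift_tile_def)
  then show ?thesis
    unfolding patch_def shift_def by blast
qed

lemma agree_on_shift:
  "agree_on A T T' \<Longrightarrow> agree_on ((\<lambda>x. x - s) ` A) (shift s T) (shift s T')"
  by (simp add: agree_on_def patch_shift)

lemma agree_on_mono:
  assumes "agree_on B T T'" "A \<subseteq> B" shows "agree_on A T T'"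
proof -
  have "patch A U = patch A (patch B U)" for U :: "'a tile set"
    using assms(2) by (auto simp: patch_def)
  then show ?thesis using assms(1) by (metis agree_on_def)
qed

lemma image_diff_atLeastAtMost_real:
  "(\<lambda>x. x - s) ` {a..b} = {a - s..b - s}" for a b s :: real
  by (simp add: image_diff_atLeastAtMost)

lemma tilings_close_commute: "tilings_close \<epsilon> T T' \<longleftrightarrow> tilings_close \<epsilon> T' T"
  unfolding tilings_close_def agree_on_def by metis

lemma tilings_close_triangle:
  assumes "0 < e1" "0 < e2" "e1 + e2 < 1"
    and "tilings_close e1 T T'" and "tilings_close e2 T' T''"
  shows "tilings_close (e1 + e2) T T''"
proof -
  obtain s1 s2 where s: "\<bar>s1\<bar> \<le> e1 / 2" "\<bar>s2\<bar> \<le> e1 / 2"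
      "agree_on {- (1 / e1)..1 / e1} (shift s1 T) (shift s2 T')"
    using assms(4) unfolding tilings_close_def by blast
  obtain u1 u2 where u: "\<bar>u1\<bar> \<le> e2 / 2" "\<bar>u2\<bar> \<le> e2 / 2"
      "agree_on {- (1 / e2)..1 / e2} (shift u1 T') (shift u2 T'')"
    using assms(5) unfolding tilings_close_def by blast
  let ?r = "1 / (e1 + e2)"
  have bound: "1 / (a + b) + b / 2 \<le> 1 / a" if "0 < a" "0 < b" "a + b < 1" for a b :: real
  proof -
    have "a * (a + b) \<le> 1 * 1" using that by (intro mult_mono) auto
    then have "b / 2 \<le> b / (a * (a + b))"
      using that \<open>a * (a + b) \<le> 1 * 1\<close> by (intro divide_left_mono) auto
    also have "\<dots> = 1 / a - 1 / (a + b)" using that by (simp add: field_simps)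
    finally show ?thesis by simp
  qed
  have b1: "?r + e2 / 2 \<le> 1 / e1" using bound[of e1 e2] assms by simp
  have b2: "?r + e1 / 2 \<le> 1 / e2" using bound[of e2 e1] assms by (simp add: add.commute)
  have "agree_on {- ?r..?r} (shift u1 (shift s1 T)) (shift u1 (shift s2 T'))"
  proof (rule agree_on_mono[OF agree_on_shift[OF s(3), of u1]])
    show "{- ?r..?r} \<subseteq> (\<lambda>x. x - u1) ` {- (1 / e1)..1 / e1}"
      unfolding image_diff_atLeastAtMost_real using b1 u(1) by (auto simp: abs_if split: if_splits)
  qed
  moreover have "agree_on {- ?r..?r} (shift s2 (shift u1 T')) (shift s2 (shift u2 T''))"
  proof (rule agree_on_mono[OF agree_on_shift[OF u(3), of s2]])
    show "{- ?r..?r} \<subseteq> (\<lambda>x. x - s2) ` {- (1 / e2)..1 / e2}"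
      unfolding image_diff_atLeastAtMost_real using b2 s(2) by (auto simp: abs_if split: if_splits)
  qed
  ultimately have "agree_on {- ?r..?r} (shift (s1 + u1) T) (shift (s2 + u2) T'')"
    by (simp add: shift_shift agree_on_def add.commute)
  moreover have "\<bar>s1 + u1\<bar> \<le> (e1 + e2) / 2" "\<bar>s2 + u2\<bar> \<le> (e1 + e2) / 2"
    using s u by (auto simp: abs_if field_simps split: if_splits)
  ultimately show ?thesis unfolding tilings_close_def by blast
qed

lemma tilings_close_mono:
  assumes "tilings_close d T T'" "0 < d" "d \<le> e" shows "tilings_close e T T'"
proof -
  obtain s1 s2 where s: "\<bar>s1\<bar> \<le> d / 2" "\<bar>s2\<bar> \<le> d / 2"
      "agree_on {- (1 / d)..1 / d} (shift s1 T) (shift s2 T')"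
    using assms unfolding tilings_close_def by blast
  have "1 / e \<le> 1 / d" using assms by (simp add: frac_le)
  then have "agree_on {- (1 / e)..1 / e} (shift s1 T) (shift s2 T')"
    by (intro agree_on_mono[OF s(3)]) auto
  then show ?thesis unfolding tilings_close_def using s(1,2) assms(3)
    by (intro exI[of _ s1] exI[of _ s2]) auto
qed

lemma tiling_dist_bdd: "bdd_below (insert 1 {\<epsilon>. 0 < \<epsilon> \<and> \<epsilon> < 1 \<and> tilings_close \<epsilon> T T'})"
  by (rule bdd_belowI[of _ 0]) auto

lemma tiling_dist_nonneg: "0 \<le> tiling_dist T T'"
  unfolding tiling_dist_def by (rule cInf_greatest) auto

lemma tiling_dist_le_1: "tiling_dist T T' \<le> 1"
  unfolding tiling_dist_def by (rule cInf_lower[OF _ tiling_dist_bdd]) auto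

lemma tiling_dist_commute: "tiling_dist T T' = tiling_dist T' T"
  unfolding tiling_dist_def by (metis tilings_close_commute)

lemma tiling_dist_lessD:
  assumes "tiling_dist T T' < e" "e \<le> 1" shows "0 < e \<and> tilings_close e T T'"
proof -
  have "\<exists>x \<in> insert 1 {\<epsilon>. 0 < \<epsilon> \<and> \<epsilon> < 1 \<and> tilings_close \<epsilon> T T'}. x < e"
    using assms(1) unfolding tiling_dist_def by (subst (asm) cInf_less_iff[OF _ tiling_dist_bdd]) auto
  then show ?thesis using assms(2) tilings_close_mono by force
qed

lemma tiling_dist_le:
  assumes "0 < e" "tilings_close e T T'" shows "tiling_dist T T' \<le> e"
proof (cases "e < 1")
  case True
  then show ?thesis unfolding tiling_dist_def
    using assms by (intro cInf_lower[OF _ tiling_dist_bdd]) auto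
next
  case False
  then show ?thesis using tiling_dist_le_1[of T T'] by simp
qed

lemma tiling_dist_triangle: "tiling_dist T T'' \<le> tiling_dist T T' + tiling_dist T' T''"
proof (rule field_le_epsilon)
  fix e :: real assume "0 < e"
  define e1 where "e1 = tiling_dist T T' + e / 2"
  define e2 where "e2 = tiling_dist T' T'' + e / 2"
  have pos: "0 < e1" "0 < e2"
    using \<open>0 < e\<close> tiling_dist_nonneg[of T T'] tiling_dist_nonneg[of T' T'']
    by (auto simp: e1_def e2_def)
  have "tiling_dist T T'' \<le> e1 + e2"
  proof (cases "e1 + e2 < 1")
    case True
    have "tilings_close e1 T T'" "tilings_close e2 T' T''"
      using tiling_dist_lessD[of T T' e1] tiling_dist_lessD[of T' T'' e2] True pos \<open>0 < e\<close>
      by (auto simp: e1_def e2_def)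
    then show ?thesis
      using tilings_close_triangle[OF pos True] tiling_dist_le pos by (metis add_pos_pos)
  next
    case False
    then show ?thesis using tiling_dist_le_1[of T T''] by simp
  qed
  then show "tiling_dist T T'' \<le> tiling_dist T T' + tiling_dist T' T'' + e"
    by (simp add: e1_def e2_def)
qed

lemma tiling_dist_self: "tiling_dist T T = 0"
proof (rule antisym[OF field_le_epsilon tiling_dist_nonneg])
  fix e :: real assume "0 < e"
  then have "tilings_close e T T"
    unfolding tilings_close_def by (intro exI[of _ 0]) (auto simp: agree_on_def)
  then show "tiling_dist T T \<le> 0 + e" using \<open>0 < e\<close> tiling_dist_le by simp
qed

lemma tiling_dist_0_subset:
  assumes T: "tiling T" and T': "tiling T'" and d: "tiling_dist T T' = 0"
  shows "T \<subseteq> T'"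
proof
  fix t assume t: "t \<in> T"
  have "\<forall>t\<in>T. \<exists>a b. a < b \<and> fst t = {a..b}"
    using T unfolding tiling_def by (elim conjE)
  then obtain a b where ab: "a < b" "fst t = {a..b}" using t by blast
  have disj: "\<forall>t\<in>T'. \<forall>u\<in>T'. t \<noteq> u \<longrightarrow> interior (fst t) \<inter> interior (fst u) = {}"
    using T' unfolding tiling_def by (elim conjE)
  define e0 where "e0 = min (1/4) (min ((b - a) / 4) (1 / (\<bar>a\<bar> + 1)))"
  have "0 < e0"
    using ab(1) by (simp add: e0_def)
  moreover have "e0 \<le> 1/4" "e0 \<le> (b - a) / 4" "e0 \<le> 1 / (\<bar>a\<bar> + 1)"
    unfolding e0_def by (rule min.cobounded1, rule min.coboundedI2, rule min.cobounded1,
      rule min.coboundedI2, rule min.cobounded2)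
  ultimately have e0: "0 < e0" "e0 \<le> 1/4" "e0 \<le> (b - a) / 4" "e0 \<le> 1 / (\<bar>a\<bar> + 1)"
    by blast+
  have ex: "\<exists>s. \<bar>s\<bar> \<le> e \<and> shift_tile s t \<in> T'" if e: "0 < e" "e \<le> e0" for e
  proof -
    have "tilings_close e T T'"
      using tiling_dist_lessD[of T T' e] d e e0 by simp
    then obtain s1 s2 where s: "\<bar>s1\<bar> \<le> e / 2" "\<bar>s2\<bar> \<le> e / 2"
        "agree_on {- (1 / e)..1 / e} (shift s1 T) (shift s2 T')"
      unfolding tilings_close_def by blast
    have "e * (\<bar>a\<bar> + 1) \<le> 1"
      using order.trans[OF e(2) e0(4)] by (simp add: pos_le_divide_eq)
    then have "\<bar>a\<bar> + 1 \<le> 1 / e"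
      using e(1) by (simp add: pos_le_divide_eq mult.commute)
    then have "a - s1 \<in> {- (1 / e)..1 / e}" using s(1) e e0(2) by (simp add: abs_le_iff) linarith
    moreover have "a - s1 \<in> fst (shift_tile s1 t)" using ab by (auto simp: shift_tile_def)
    ultimately have "shift_tile s1 t \<in> patch {- (1 / e)..1 / e} (shift s1 T)"
      using t by (auto simp: patch_def shift_def)
    then have "shift_tile s1 t \<in> shift s2 T'" using s(3) by (auto simp: agree_on_def patch_def)
    then have "shift_tile (- s2 + s1) t \<in> T'" by (simp add: mem_shift_iff shift_tile_shift_tile)
    moreover have "\<bar>- s2 + s1\<bar> \<le> e" using s(1,2) by linarith
    ultimately show ?thesis by blast
  qed
  obtain s where s: "\<bar>s\<bar> \<le> e0" "shift_tile s t \<in> T'" using ex[of e0] e0 by auto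
  have "\<bar>s\<bar> \<le> 0 + e" if e: "0 < e" for e
  proof -
    obtain r where r: "\<bar>r\<bar> \<le> min e e0" "shift_tile r t \<in> T'"
      using ex[of "min e e0"] e0(1) e by auto
    have r0: "\<bar>r\<bar> \<le> e0" using r(1) by simp
    have mid: "a - c < (a + b) / 2 \<and> (a + b) / 2 < b - c" if c: "\<bar>c\<bar> \<le> e0" for c
    proof -
      have "4 * c \<le> b - a" "- (4 * c) \<le> b - a"
        using c e0(3) by (simp_all add: abs_le_iff)
      then show ?thesis using ab(1) by (simp add: field_simps)
    qed
    have "interior (fst (shift_tile s t)) \<inter> interior (fst (shift_tile r t)) \<noteq> {}"
    proof -
      have "(a + b) / 2 \<in> {a - s<..<b - s} \<inter> {a - r<..<b - r}"
        unfolding Int_iff greaterThanLessThan_iff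
        using mid[OF s(1)] mid[OF r0] by blast
      then show ?thesis
        unfolding shift_tile_def fst_conv ab(2) image_diff_atLeastAtMost_real
          interior_atLeastAtMost_real by blast
    qed
    then have "shift_tile s t = shift_tile r t" using disj s(2) r(2) by blast
    then have "{a - s..b - s} = {a - r..b - r}"
      by (simp add: shift_tile_def ab image_diff_atLeastAtMost_real)
    then have "s = r" using ab(1) by (simp add: Icc_eq_Icc)
    then show ?thesis using r(1) by simp
  qed
  then have "s = 0" using field_le_epsilon[of "\<bar>s\<bar>" 0] by simp
  then show "t \<in> T'" using s(2) by simp
qed

lemma Metric_space_tilings: "Metric_space {T. tiling T} tiling_dist"
proof
  fix x y z :: "'l tile set"
  show "0 \<le> tiling_dist x y" by (rule tiling_dist_nonneg)
  show "tiling_dist x y = tiling_dist y x" by (rule tiling_dist_commute)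
  show "tiling_dist x z \<le> tiling_dist x y + tiling_dist y z" by (rule tiling_dist_triangle)
  assume "x \<in> {T. tiling T}" and "y \<in> {T. tiling T}"
  then have xy: "tiling x" "tiling y" by simp_all
  show "tiling_dist x y = 0 \<longleftrightarrow> x = y"
  proof
    assume d: "tiling_dist x y = 0"
    then have "tiling_dist y x = 0" by (simp only: tiling_dist_commute[of y x])
    then show "x = y"
      using tiling_dist_0_subset[OF xy d] tiling_dist_0_subset[OF xy(2,1)] by simp
  qed (simp add: tiling_dist_self)
qed


section \<open>Tiling spaces\<close>

definition tilings_topology :: "'l tile set topology" where
  "tilings_topology = Metric_space.mtopology {T. tiling T} tiling_dist"

definition orbit_closure :: "'l tile set \<Rightarrow> 'l tile set set" where
  "orbit_closure T = tilings_topology closure_of (range (\<lambda>s. shift s T))"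

definition space_topology :: "'l tile set set \<Rightarrow> 'l tile set topology" where
  "space_topology \<Omega> = subtopology tilings_topology \<Omega>"

definition repetitive :: "'l tile set \<Rightarrow> bool" where
  "repetitive T \<longleftrightarrow>
     (\<forall>P. finite P \<and> P \<subseteq> T \<longrightarrow>
        (\<exists>L>0. \<forall>a. \<exists>s. shift s P \<subseteq> T \<and> (\<Union>t\<in>shift s P. fst t) \<subseteq> {a..a + L}))"

definition nonperiodic :: "'l tile set \<Rightarrow> bool" where
  "nonperiodic T \<longleftrightarrow> (\<forall>s. s \<noteq> 0 \<longrightarrow> shift s T \<noteq> T)"

definition tiling_space :: "'l tile set set \<Rightarrow> bool" where
  "tiling_space \<Omega> \<longleftrightarrow>
     (\<exists>T. tiling T \<and> repetitive T \<and> nonperiodic T \<and> \<Omega> = orbit_closure T)"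

definition space_borel :: "'l tile set set \<Rightarrow> 'l tile set measure" where
  "space_borel \<Omega> = sigma \<Omega> {U. openin (space_topology \<Omega>) U}"

definition uniquely_ergodic :: "'l tile set set \<Rightarrow> bool" where
  "uniquely_ergodic \<Omega> \<longleftrightarrow>
     (\<exists>!M. sets M = sets (space_borel \<Omega>) \<and> prob_space M \<and> (\<forall>s. distr M M (shift s) = M))"

text \<open>Minimality of the action of the group generated by \<open>shift 1\<close>: every orbit is dense.\<close>

definition minimal_under_unit_shift :: "'l tile set set \<Rightarrow> bool" where
  "minimal_under_unit_shift \<Omega> \<longleftrightarrow>
     (\<forall>S\<in>\<Omega>. space_topology \<Omega> closure_of (range (\<lambda>n::int. shift (of_int n) S)) = \<Omega>)"


section \<open>Pattern equivariance\<close>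

definition pattern_equivariant :: "'l tile set \<Rightarrow> real \<Rightarrow> (real \<Rightarrow> real) \<Rightarrow> bool" where
  "pattern_equivariant T R \<phi> \<longleftrightarrow>
     (\<forall>x1 x2. agree_on {-R..R} (shift x1 T) (shift x2 T) \<longrightarrow> \<phi> x1 = \<phi> x2)"

definition sPE :: "'l tile set \<Rightarrow> (real \<Rightarrow> real) \<Rightarrow> bool" where
  "sPE T \<phi> \<longleftrightarrow> continuous_on UNIV \<phi> \<and> (\<exists>R>0. pattern_equivariant T R \<phi>)"

definition sPE_on_space :: "'l tile set set \<Rightarrow> ('l tile set \<Rightarrow> real) \<Rightarrow> bool" where
  "sPE_on_space \<Omega> G \<longleftrightarrow>
     continuous_map (space_topology \<Omega>) euclideanreal G \<and>
     (\<exists>T\<in>\<Omega>. sPE T (\<lambda>x. G (shift x T)))"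

text \<open>
  A 1-form \<open>g(x) dx\<close> is represented by its coefficient function \<open>g\<close>; it is sPE iff \<open>g\<close> is.
\<close>

definition cohomologous :: "'l tile set \<Rightarrow> (real \<Rightarrow> real) \<Rightarrow> (real \<Rightarrow> real) \<Rightarrow> bool" where
  "cohomologous T \<mu> \<nu> \<longleftrightarrow>
     sPE T \<mu> \<and> sPE T \<nu> \<and>
     (\<exists>g. sPE T g \<and> (\<forall>x. (g has_real_derivative (\<mu> x - \<nu> x)) (at x)))"


section \<open>Self-homeomorphisms and rotation forms\<close>

definition displacement_homeos :: "'l tile set set \<Rightarrow> ('l tile set \<Rightarrow> 'l tile set) set" where
  "displacement_homeos \<Omega> =
     {F. homeomorphic_map (space_topology \<Omega>) (space_topology \<Omega>) F \<and>
         homotopic_with (\<lambda>_. True) (space_topology \<Omega>) (space_topology \<Omega>) F id \<and>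
         (\<exists>\<Phi>. sPE_on_space \<Omega> \<Phi> \<and> (\<forall>T\<in>\<Omega>. F T = shift (\<Phi> T) T))}"

text \<open>The description is definite because all tilings of a tiling space are non-periodic.\<close>

definition orbit_map :: "('l tile set \<Rightarrow> 'l tile set) \<Rightarrow> 'l tile set \<Rightarrow> real \<Rightarrow> real" where
  "orbit_map F T x = (THE y. F (shift x T) = shift y T)"

definition int_iterate :: "('a \<Rightarrow> 'a) \<Rightarrow> int \<Rightarrow> 'a \<Rightarrow> 'a" where
  "int_iterate f n = (if 0 \<le> n then f ^^ nat n else inv f ^^ nat (- n))"

definition strictly_between :: "real \<Rightarrow> real \<Rightarrow> real \<Rightarrow> bool" where
  "strictly_between a x b \<longleftrightarrow> (a < x \<and> x < b) \<or> (b < x \<and> x < a)"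

text \<open>The interval integral is signed, so \<open>x2 < x1\<close> is covered.\<close>

definition rotation_form ::
  "('l tile set \<Rightarrow> 'l tile set) \<Rightarrow> 'l tile set \<Rightarrow> (real \<Rightarrow> real) \<Rightarrow> bool" where
  "rotation_form F T \<mu> \<longleftrightarrow>
     sPE T \<mu> \<and>
     (\<exists>R>0. \<forall>x1 x2 :: real. \<forall>m n :: int.
        agree_on {-R..R} (shift x1 T) (shift x2 T) \<and>
        of_int m < (LBINT x=x1..x2. \<mu> x) \<and> (LBINT x=x1..x2. \<mu> x) < of_int n \<longrightarrow>
        strictly_between (int_iterate (orbit_map F T) m x1) x2 (int_iterate (orbit_map F T) n x1))"


section \<open>Shape changes and irrationality\<close>

text \<open>
  The collared label of \<open>t\<close> is the pattern of \<open>T\<close> out to distance \<open>R\<close> from \<open>t\<close>, translated so that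
  \<open>t\<close> becomes the tile with left endpoint \<open>0\<close>; in particular it determines the label of \<open>t\<close>.
\<close>

definition collar :: "'l tile set \<Rightarrow> real \<Rightarrow> 'l tile \<Rightarrow> 'l tile set" where
  "collar T R t =
     shift (Inf (fst t)) (patch {Inf (fst t) - R..Sup (fst t) + R} T)"

text \<open>
  The closed segment between the moved endpoints is the right tile for forms of either sign:
  for a negative form the two endpoints appear in reverse order.
\<close>

definition reshaped_tiling ::
  "'l tile set \<Rightarrow> real \<Rightarrow> (real \<Rightarrow> real) \<Rightarrow> 'l tile set tile set" where
  "reshaped_tiling T R \<mu> =
     (\<lambda>t. (closed_segment (LBINT x=0..Inf (fst t). \<mu> x) (LBINT x=0..Sup (fst t). \<mu> x),
           collar T R t)) ` T"

definition shape_change ::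
  "'l tile set \<Rightarrow> real \<Rightarrow> (real \<Rightarrow> real) \<Rightarrow> 'l tile set tile set set" where
  "shape_change T R \<mu> = orbit_closure (reshaped_tiling T R \<mu>)"

definition irrational_class :: "'l tile set \<Rightarrow> (real \<Rightarrow> real) \<Rightarrow> bool" where
  "irrational_class T \<mu> \<longleftrightarrow>
     (\<exists>\<mu>' R. cohomologous T \<mu>' \<mu> \<and> 0 < R \<and> pattern_equivariant T R \<mu>' \<and>
        ((\<forall>x. 0 < \<mu>' x) \<or> (\<forall>x. \<mu>' x < 0)) \<and>
        minimal_under_unit_shift (shape_change T R \<mu>'))"

end

theory Submission
  imports Defs
begin

text \<open>
  Write \<open>f\<close> for the orbit map and call \<open>y\<close> a return of \<open>x\<close> if the tiling looks the same around
  both points out to the radius of the two rotation forms. Taking equal base points in the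
  definition of a rotation form shows that \<open>f\<close> moves all points in the same direction, so the
  iterates \<open>f\<^sup>n(x)\<close> are monotone in \<open>n\<close> and for returns the integrals of \<open>\<mu>\<close> and \<open>\<nu>\<close> from
  \<open>x\<close> to \<open>y\<close> are never separated by an integer. Hence the integral of \<open>\<mu> - \<nu>\<close> over return paths
  is bounded, and a Gottschalk--Hedlund argument makes it small for returns that agree on a large
  ball. If it were nonzero for some return \<open>y\<close> of \<open>x\<close>, then minimality of the unit translation on
  the shape change would provide a point, close to \<open>y\<close> in the hull, for which an integer does
  separate the two integrals. So a primitive of \<open>\<mu> - \<nu>\<close> is pattern equivariant.
\<close>

section \<open>Combinatorics of tilings of the line\<close>

abbreviation lo :: "'l tile \<Rightarrow> real" where "lo t \<equiv> Inf (fst t)"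
abbreviation hi :: "'l tile \<Rightarrow> real" where "hi t \<equiv> Sup (fst t)"

lemma tilingD:
  assumes "tiling T"
  shows "\<forall>t\<in>T. \<exists>a b. a < b \<and> fst t = {a..b}"
    and "finite (snd ` T)"
    and "\<forall>t\<in>T. \<forall>u\<in>T. snd t = snd u \<longrightarrow> tile_length t = tile_length u"
    and "\<forall>t\<in>T. \<forall>u\<in>T. t \<noteq> u \<longrightarrow> interior (fst t) \<inter> interior (fst u) = {}"
    and "(\<Union>t\<in>T. fst t) = UNIV"
  using assms unfolding tiling_def by - (elim conjE, assumption)+

lemma tile_interval:
  assumes "tiling T" "t \<in> T"
  shows "fst t = {lo t..hi t}" and "lo t < hi t"
proof -
  obtain a b where "a < b" "fst t = {a..b}"
    using tilingD(1)[OF assms(1)] assms(2) by blast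
  then show "fst t = {lo t..hi t}" "lo t < hi t" by auto
qed

lemma tile_eq:
  assumes "tiling T" "t \<in> T" shows "t = ({lo t..hi t}, snd t)"
  using tile_interval(1)[OF assms] by (metis prod.collapse)

lemma tiling_covers:
  assumes "tiling T"
  obtains t where "t \<in> T" "lo t \<le> x" "x \<le> hi t"
proof -
  have "x \<in> (\<Union>t\<in>T. fst t)"
    using tilingD(5)[OF assms] by simp
  then obtain t where t: "t \<in> T" "x \<in> fst t" by blast
  then have "x \<in> {lo t..hi t}" using tile_interval(1)[OF assms t(1)] by metis
  then show ?thesis using that t(1) by simp
qed

lemma tiles_ordered:
  assumes "tiling T" "t \<in> T" "u \<in> T" "t \<noteq> u"
  shows "hi t \<le> lo u \<or> hi u \<le> lo t"
proof (rule ccontr)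
  assume "\<not> ?thesis"
  moreover note tile_interval(2)[OF assms(1,2)] tile_interval(2)[OF assms(1,3)]
  ultimately have "max (lo t) (lo u) < min (hi t) (hi u)" by auto
  then obtain z where "max (lo t) (lo u) < z" "z < min (hi t) (hi u)" using dense by blast
  then have "z \<in> interior {lo t..hi t}" "z \<in> interior {lo u..hi u}" by auto
  moreover have "interior (fst t) \<inter> interior (fst u) = {}"
    using tilingD(4)[OF assms(1)] assms(2-4) by simp
  ultimately show False
    using tile_interval(1)[OF assms(1,2)] tile_interval(1)[OF assms(1,3)] by (metis disjoint_iff)
qed

lemma tile_eqI:
  assumes "tiling T" "t \<in> T" "u \<in> T" "lo t \<le> x" "x \<le> hi t" "lo u < x" "x < hi u"
  shows "t = u"
  using tiles_ordered[OF assms(1-3)] assms(4-) by force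

lemma tile_eq_if_lo_eq:
  assumes "tiling T" "t \<in> T" "u \<in> T" "lo t = lo u" shows "t = u"
  using tiles_ordered[OF assms(1-3)] assms(4) tile_interval(2)[OF assms(1,2)]
    tile_interval(2)[OF assms(1,3)] by force

lemma
  assumes "tiling T" "t \<in> T"
  shows lo_shift_tile: "lo (shift_tile s t) = lo t - s"
    and hi_shift_tile: "hi (shift_tile s t) = hi t - s"
proof -
  have "fst (shift_tile s t) = {lo t - s..hi t - s}"
    unfolding shift_tile_def fst_conv
    using tile_interval(1)[OF assms] by (metis image_diff_atLeastAtMost_real)
  then show "lo (shift_tile s t) = lo t - s" "hi (shift_tile s t) = hi t - s"
    using tile_interval(2)[OF assms] by simp_all
qed

lemma snd_shift_tile [simp]: "snd (shift_tile s t) = snd t"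
  by (simp add: shift_tile_def)

lemma mem_patch_iff:
  assumes "tiling T" "t \<in> T" "a \<le> b"
  shows "t \<in> patch {a..b} T \<longleftrightarrow> lo t \<le> b \<and> a \<le> hi t"
proof -
  have "t \<in> patch {a..b} T \<longleftrightarrow> {lo t..hi t} \<inter> {a..b} \<noteq> {}"
    using tile_interval(1)[OF assms(1,2)] assms(2) unfolding patch_def by simp
  then show ?thesis
    using tile_interval(2)[OF assms(1,2)] assms(3) by auto
qed

lemma tiling_shift:
  assumes "tiling T" shows "tiling (shift s T)"
proof -
  have len: "tile_length (shift_tile s t) = tile_length t" if "t \<in> T" for t
    unfolding tile_length_def
    using lo_shift_tile[OF assms that] hi_shift_tile[OF assms that] by simp
  have fst: "fst (shift_tile s t) = {lo t - s..hi t - s}" if "t \<in> T" for t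
    unfolding shift_tile_def fst_conv
    using tile_interval(1)[OF assms that] by (metis image_diff_atLeastAtMost_real)
  have 1: "\<forall>t\<in>shift s T. \<exists>a b. a < b \<and> fst t = {a..b}"
  proof
    fix t assume "t \<in> shift s T"
    then obtain u where u: "u \<in> T" "t = shift_tile s u" by (auto simp: shift_def)
    then show "\<exists>a b. a < b \<and> fst t = {a..b}"
      using fst[OF u(1)] tile_interval(2)[OF assms u(1)]
      by (intro exI[of _ "lo u - s"] exI[of _ "hi u - s"]) simp
  qed
  have 2: "finite (snd ` shift s T)"
    using tilingD(2)[OF assms] by (simp add: shift_def image_image)
  have 3: "\<forall>t\<in>shift s T. \<forall>u\<in>shift s T. snd t = snd u \<longrightarrow> tile_length t = tile_length u"
  proof (intro ballI impI)
    fix t u assume "t \<in> shift s T" "u \<in> shift s T" and eq: "snd t = snd u"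
    then obtain t' u' where tu: "t' \<in> T" "u' \<in> T" "t = shift_tile s t'" "u = shift_tile s u'"
      unfolding shift_def by blast
    then have "snd t' = snd u'" using eq by simp
    then show "tile_length t = tile_length u"
      using tilingD(3)[OF assms] tu(1,2) len unfolding tu(3,4) by metis
  qed
  have 4: "\<forall>t\<in>shift s T. \<forall>u\<in>shift s T. t \<noteq> u \<longrightarrow> interior (fst t) \<inter> interior (fst u) = {}"
  proof (intro ballI impI)
    fix t u assume "t \<in> shift s T" "u \<in> shift s T" "t \<noteq> u"
    then obtain t' u' where tu: "t' \<in> T" "u' \<in> T" "t = shift_tile s t'" "u = shift_tile s u'" "t' \<noteq> u'"
      by (auto simp: shift_def)
    show "interior (fst t) \<inter> interior (fst u) = {}"
      using tiles_ordered[OF assms tu(1,2,5)] fst[OF tu(1)] fst[OF tu(2)]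
      unfolding tu(3,4) by auto
  qed
  have 5: "(\<Union>t\<in>shift s T. fst t) = UNIV"
  proof -
    have "x \<in> (\<Union>t\<in>shift s T. fst t)" for x
    proof -
      obtain t where t: "t \<in> T" "lo t \<le> x + s" "x + s \<le> hi t"
        using tiling_covers[OF assms] .
      then have "x \<in> fst (shift_tile s t)" unfolding fst[OF t(1)] by auto
      then show ?thesis using t(1) unfolding shift_def by blast
    qed
    then show ?thesis by blast
  qed
  show ?thesis unfolding tiling_def by (intro conjI 1 2 3 4 5)
qed

section \<open>Finite local complexity: lengths, offsets and patches\<close>

lemma finite_tile_lengths:
  assumes "tiling T" shows "finite (tile_length ` T)"
proof -
  define f where "f l = tile_length (SOME t. t \<in> T \<and> snd t = l)" for l
  have "tile_length t = f (snd t)" if "t \<in> T" for t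
  proof -
    have "(SOME u. u \<in> T \<and> snd u = snd t) \<in> T \<and> snd (SOME u. u \<in> T \<and> snd u = snd t) = snd t"
      using that by (rule_tac someI[of _ t]) simp
    then show ?thesis using tilingD(3)[OF assms] that unfolding f_def by metis
  qed
  then have "tile_length ` T \<subseteq> f ` snd ` T" by auto
  moreover have "finite (snd ` T)" by (rule tilingD(2)[OF assms])
  ultimately show ?thesis using finite_subset by blast
qed

lemma min_tile_length:
  assumes "tiling T"
  obtains l where "0 < l" "\<And>t. t \<in> T \<Longrightarrow> l \<le> hi t - lo t"
proof
  obtain t where "t \<in> T" using tiling_covers[OF assms] by metis
  then have ne: "tile_length ` T \<noteq> {}" by blast
  show "0 < Min (tile_length ` T)"
    using finite_tile_lengths[OF assms] ne tile_interval(2)[OF assms]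
    by (auto simp: tile_length_def)
  show "Min (tile_length ` T) \<le> hi t - lo t" if "t \<in> T" for t
    using finite_tile_lengths[OF assms] that unfolding tile_length_def by (intro Min_le) auto
qed

text \<open>The tile over the point half a minimal length \<open>l\<close> to the right of
  \<open>t\<close> has to start at \<open>hi t\<close>: a gap would contain a whole tile shorter
  than \<open>l\<close>.\<close>

lemma next_tile:
  assumes T: "tiling T" and t: "t \<in> T"
  obtains u where "u \<in> T" "lo u = hi t"
proof -
  obtain l where l: "0 < l" "\<And>t. t \<in> T \<Longrightarrow> l \<le> hi t - lo t"
    using min_tile_length[OF T] by blast
  obtain u where u: "u \<in> T" "lo u \<le> hi t + l / 2" "hi t + l / 2 \<le> hi u"
    using tiling_covers[OF T] .
  have "t \<noteq> u" using u l(1) by auto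
  then have ge: "hi t \<le> lo u"
    using tiles_ordered[OF T t u(1)] u l(1) tile_interval(2)[OF T t] by auto
  have "lo u = hi t"
  proof (rule ccontr)
    assume "lo u \<noteq> hi t"
    then have gt: "hi t < lo u" using ge by simp
    obtain v where v: "v \<in> T" "lo v \<le> (hi t + lo u) / 2" "(hi t + lo u) / 2 \<le> hi v"
      using tiling_covers[OF T] .
    have "v \<noteq> t" "v \<noteq> u" using v gt by auto
    then have "hi t \<le> lo v" "hi v \<le> lo u"
      using tiles_ordered[OF T t v(1)] tiles_ordered[OF T u(1) v(1)] v gt
        tile_interval(2)[OF T t] tile_interval(2)[OF T u(1)] by auto
    then show False using l(2)[OF v(1)] u(2) l(1) by simp
  qed
  then show ?thesis using that u(1) by blast
qed

text \<open>Stepping to the next tile shortens a positive offset by a length from a finite set, and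
  by at least the minimal length \<open>l\<close>; hence the induction on the bound in units of
  \<open>l\<close>. Negative offsets are obtained by exchanging the two tiles.\<close>

lemma finite_tile_offsets:
  assumes T: "tiling T"
  shows "finite {lo u - lo t |t u. t \<in> T \<and> u \<in> T \<and> \<bar>lo u - lo t\<bar> \<le> K}"
proof -
  obtain l where l: "0 < l" "\<And>t. t \<in> T \<Longrightarrow> l \<le> hi t - lo t"
    using min_tile_length[OF T] by blast
  define S where "S n = {lo u - lo t |t u. t \<in> T \<and> u \<in> T \<and> 0 \<le> lo u - lo t \<and> lo u - lo t \<le> real n * l}"
    for n :: nat
  have "finite (S n)" for n
  proof (induction n)
    case 0
    have "S 0 \<subseteq> {0}" by (auto simp: S_def)
    then show ?case using finite_subset by blast
  next
    case (Suc n)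
    have "S (Suc n) \<subseteq> insert 0 ((\<lambda>(x, y). x + y) ` (tile_length ` T \<times> S n))"
    proof
      fix d assume "d \<in> S (Suc n)"
      then obtain t u where tu: "t \<in> T" "u \<in> T" "d = lo u - lo t" "0 \<le> d" "d \<le> real (Suc n) * l"
        by (auto simp: S_def)
      show "d \<in> insert 0 ((\<lambda>(x, y). x + y) ` (tile_length ` T \<times> S n))"
      proof (cases "t = u")
        case False
        obtain v where v: "v \<in> T" "lo v = hi t" using next_tile[OF T tu(1)] .
        have "hi t \<le> lo u"
          using tiles_ordered[OF T tu(1,2) False] tu(3,4) tile_interval(2)[OF T tu(2)] by linarith
        moreover have "lo u - hi t \<le> real n * l"
          using l(2)[OF tu(1)] tu(3,5) by (simp add: algebra_simps)
        ultimately have "0 \<le> lo u - lo v" "lo u - lo v \<le> real n * l" using v(2) by simp_all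
        then have "lo u - lo v \<in> S n" unfolding S_def using v(1) tu(2) by blast
        moreover have "d = tile_length t + (lo u - lo v)"
          using tu(3) v(2) by (simp add: tile_length_def)
        ultimately show ?thesis using tu(1) by force
      qed (use tu in auto)
    qed
    moreover have "finite (insert 0 ((\<lambda>(x, y). x + y) ` (tile_length ` T \<times> S n)))"
      using Suc finite_tile_lengths[OF T] by auto
    ultimately show ?case using finite_subset by blast
  qed
  obtain n where n: "K / l \<le> real n" using real_arch_simple by blast
  then have n: "K \<le> real n * l" using l(1) by (simp add: field_simps)
  have "{lo u - lo t |t u. t \<in> T \<and> u \<in> T \<and> \<bar>lo u - lo t\<bar> \<le> K} \<subseteq> S n \<union> uminus ` S n"
  proof
    fix d assume "d \<in> {lo u - lo t |t u. t \<in> T \<and> u \<in> T \<and> \<bar>lo u - lo t\<bar> \<le> K}"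
    then obtain t u where tu: "t \<in> T" "u \<in> T" "d = lo u - lo t" "\<bar>d\<bar> \<le> K" by blast
    show "d \<in> S n \<union> uminus ` S n"
    proof (cases "0 \<le> d")
      case True
      then have "0 \<le> lo u - lo t" "lo u - lo t \<le> real n * l" using tu(3,4) n by simp_all
      then show ?thesis using tu(1-3) unfolding S_def by blast
    next
      case False
      then have "0 \<le> lo t - lo u" "lo t - lo u \<le> real n * l" using tu(3,4) n by simp_all
      then have "lo t - lo u \<in> S n" using tu(1,2) unfolding S_def by blast
      then have "- (lo t - lo u) \<in> uminus ` S n" by (rule imageI)
      then show ?thesis using tu(3) by simp
    qed
  qed
  then show ?thesis using \<open>finite (S n)\<close> finite_subset by blast
qed

text \<open>Repetitivity speaks of finite patterns, so it applies to bounded patches only once they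
  are known to be finite. A tile is determined by its left endpoint, and measured from one fixed
  tile the left endpoints are among finitely many offsets.\<close>

lemma finite_patch:
  assumes T: "tiling T" shows "finite (patch {a..b} T)"
proof (cases "a \<le> b")
  case True
  obtain t0 where t0: "t0 \<in> T" using tiling_covers[OF T] by metis
  obtain M where M: "\<And>t. t \<in> T \<Longrightarrow> hi t - lo t \<le> M"
    using Max_ge[OF finite_tile_lengths[OF T]] unfolding tile_length_def by blast
  define K where "K = \<bar>a\<bar> + \<bar>b\<bar> + \<bar>M\<bar> + \<bar>lo t0\<bar>"
  have "(\<lambda>t. lo t - lo t0) ` patch {a..b} T
      \<subseteq> {lo u - lo t |t u. t \<in> T \<and> u \<in> T \<and> \<bar>lo u - lo t\<bar> \<le> K}"
  proof (rule image_subsetI)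
    fix t assume t: "t \<in> patch {a..b} T"
    then have tT: "t \<in> T" by (auto simp: patch_def)
    have "lo t \<le> b" "a \<le> hi t" using mem_patch_iff[OF T tT True] t by auto
    then have "\<bar>lo t - lo t0\<bar> \<le> K" using M[OF tT] unfolding K_def by arith
    then show "lo t - lo t0 \<in> {lo u - lo t |t u. t \<in> T \<and> u \<in> T \<and> \<bar>lo u - lo t\<bar> \<le> K}"
      using t0 tT by blast
  qed
  then have "finite ((\<lambda>t. lo t - lo t0) ` patch {a..b} T)"
    using finite_tile_offsets[OF T] finite_subset by blast
  moreover have "inj_on (\<lambda>t. lo t - lo t0) (patch {a..b} T)"
    unfolding patch_def by (rule inj_onI, rule tile_eq_if_lo_eq[OF T]) simp_all
  ultimately show ?thesis using finite_imageD by blast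
next
  case False
  then show ?thesis by (simp add: patch_def)
qed

section \<open>Collared labels\<close>

lemma collar_eq_patch:
  "collar T R t = patch {- R..hi t - lo t + R} (shift (lo t) T)"
  unfolding collar_def patch_shift[symmetric] image_diff_atLeastAtMost_real
  by (simp add: algebra_simps)

text \<open>A tile in a collar is determined by its offset from the central tile, its length and its
  label. Each takes finitely many values, so all collars are subsets of one finite set. This gives
  the reshaped tiling its finite alphabet.\<close>

lemma finite_collars:
  assumes T: "tiling T" and R: "0 \<le> R" shows "finite (collar T R ` T)"
proof -
  obtain M where M: "\<And>t. t \<in> T \<Longrightarrow> hi t - lo t \<le> M"
    using Max_ge[OF finite_tile_lengths[OF T]] unfolding tile_length_def by blast
  define X where "X = {lo u - lo t |t u. t \<in> T \<and> u \<in> T \<and> \<bar>lo u - lo t\<bar> \<le> R + M}"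
  define Y where "Y = (\<lambda>(d, l, c). ({d..d + l}, c)) ` (X \<times> tile_length ` T \<times> snd ` T)"
  have "finite (snd ` T)" by (rule tilingD(2)[OF T])
  then have "finite Y"
    unfolding Y_def X_def using finite_tile_offsets[OF T] finite_tile_lengths[OF T] by blast
  moreover have "collar T R ` T \<subseteq> Pow Y"
  proof (rule image_subsetI, rule PowI, rule subsetI)
    fix t v assume t: "t \<in> T" and "v \<in> collar T R t"
    then obtain u where u: "u \<in> patch {lo t - R..hi t + R} T" "v = shift_tile (lo t) u"
      unfolding collar_def shift_def by blast
    then have uT: "u \<in> T" by (auto simp: patch_def)
    have "lo u \<le> hi t + R" "lo t - R \<le> hi u"
      using mem_patch_iff[OF T uT, of "lo t - R" "hi t + R"] u(1) R tile_interval(2)[OF T t] by auto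
    then have "\<bar>lo u - lo t\<bar> \<le> R + M" using M[OF t] M[OF uT] by linarith
    then have "lo u - lo t \<in> X" unfolding X_def using t uT by blast
    moreover have "v = ({lo u - lo t..lo u - lo t + tile_length u}, snd u)"
    proof -
      have "v = ({lo v..hi v}, snd v)"
        using u(2) uT tile_eq[OF tiling_shift[OF T]] unfolding shift_def by blast
      then show ?thesis
        unfolding u(2) lo_shift_tile[OF T uT] hi_shift_tile[OF T uT] by (simp add: tile_length_def)
    qed
    ultimately show "v \<in> Y" unfolding Y_def using uT by force
  qed
  ultimately show ?thesis using finite_subset by blast
qed

text \<open>The central tile is recovered from its collar as the tile with left endpoint 0. Since
  the collar reaches \<open>R\<close> beyond both ends of the tile, corresponding points of the two
  tiles see the same pattern out to distance \<open>R\<close>.\<close>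

lemma collar_eqD:
  assumes T: "tiling T" and R: "0 \<le> R" and t: "t \<in> T" and u: "u \<in> T"
    and eq: "collar T R t = collar T R u"
  shows "shift_tile (lo t) t = shift_tile (lo u) u"
    and "hi t - lo t = hi u - lo u"
    and "\<And>w. 0 \<le> w \<Longrightarrow> w \<le> hi t - lo t \<Longrightarrow>
          agree_on {- R..R} (shift (lo t + w) T) (shift (lo u + w) T)"
proof -
  have "t \<in> patch {lo t - R..hi t + R} T"
    using mem_patch_iff[OF T t] R tile_interval(2)[OF T t] by auto
  then have "shift_tile (lo t) t \<in> collar T R u"
    unfolding eq[symmetric] unfolding collar_def shift_def by blast
  then obtain v where v: "v \<in> T" "shift_tile (lo t) t = shift_tile (lo u) v"
    unfolding collar_def shift_def patch_def by blast
  have "lo v = lo u"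
    using arg_cong[OF v(2), of lo] unfolding lo_shift_tile[OF T t] lo_shift_tile[OF T v(1)] by simp
  then have "v = u" using tile_eq_if_lo_eq[OF T v(1) u] by simp
  then show 1: "shift_tile (lo t) t = shift_tile (lo u) u" using v by simp
  show 2: "hi t - lo t = hi u - lo u"
    using arg_cong[OF 1, of hi] unfolding hi_shift_tile[OF T t] hi_shift_tile[OF T u] .
  have "agree_on {- R..hi t - lo t + R} (shift (lo t) T) (shift (lo u) T)"
    using eq 2 unfolding agree_on_def collar_eq_patch by simp
  from agree_on_shift[OF this] have "agree_on {- R - w..hi t - lo t + R - w}
    (shift (lo t + w) T) (shift (lo u + w) T)" for w
    unfolding image_diff_atLeastAtMost_real shift_shift by (simp add: add.commute)
  then show "agree_on {- R..R} (shift (lo t + w) T) (shift (lo u + w) T)"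
    if "0 \<le> w" "w \<le> hi t - lo t" for w
    by (rule agree_on_mono) (use that in auto)
qed

text \<open>There are finitely many collars, so finitely many tiles already show every value of
  \<open>\<phi>\<close>, and the range is a finite union of continuous images of compact
  intervals.\<close>

lemma compact_range_pattern_equivariant:
  assumes T: "tiling T" and R: "0 \<le> R"
    and pe: "pattern_equivariant T R \<phi>" and cont: "continuous_on UNIV \<phi>"
  shows "compact (range \<phi>)"
proof -
  obtain U where U: "U \<subseteq> T" "finite U" "collar T R ` T = collar T R ` U"
    using finite_subset_image[OF finite_collars[OF T R] order_refl] by metis
  have "range \<phi> = (\<Union>t\<in>U. \<phi> ` {lo t..hi t})"
  proof (intro equalityI subsetI)
    fix y assume "y \<in> range \<phi>"
    then obtain x where x: "y = \<phi> x" by blast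
    obtain t where t: "t \<in> T" "lo t \<le> x" "x \<le> hi t" using tiling_covers[OF T] .
    then obtain u where u: "u \<in> U" "collar T R t = collar T R u" using U(3) by blast
    then have uT: "u \<in> T" using U(1) by blast
    note c = collar_eqD[OF T R t(1) uT u(2)]
    have "\<phi> (lo t + (x - lo t)) = \<phi> (lo u + (x - lo t))"
      using c(3)[of "x - lo t"] pe t unfolding pattern_equivariant_def by force
    then have "y = \<phi> (lo u + (x - lo t))" using x by simp
    moreover have "lo u + (x - lo t) \<in> {lo u..hi u}" using t c(2) by auto
    ultimately show "y \<in> (\<Union>t\<in>U. \<phi> ` {lo t..hi t})" using u(1) by blast
  qed auto
  moreover have "compact (\<Union>t\<in>U. \<phi> ` {lo t..hi t})"
    using U(2) by (intro compact_UN compact_continuous_image continuous_on_subset[OF cont]) auto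
  ultimately show ?thesis by simp
qed

section \<open>Shape changes\<close>

lemma interval_integral_eq_diff:
  fixes \<phi> h :: "real \<Rightarrow> real"
  assumes "continuous_on UNIV \<phi>" and "\<And>x. (h has_real_derivative \<phi> x) (at x)"
  shows "(LBINT x=a..b. \<phi> x) = h b - h a"
proof (rule interval_integral_FTC_finite)
  show "continuous_on {min a b..max a b} \<phi>"
    using assms(1) by (rule continuous_on_subset) simp
  show "(h has_vector_derivative \<phi> x) (at x within {min a b..max a b})" for x
    using assms(2) has_field_derivative_at_within has_real_derivative_iff_has_vector_derivative by blast
qed

lemma antiderivative_exists:
  fixes \<phi> :: "real \<Rightarrow> real"
  assumes "continuous_on UNIV \<phi>"
  obtains h where "\<And>x. (h has_real_derivative \<phi> x) (at x)"
proof -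
  have "\<exists>h. \<forall>x::real. - \<infinity> < ereal x \<longrightarrow> ereal x < \<infinity> \<longrightarrow> (h has_vector_derivative \<phi> x) (at x)"
    using assms by (intro einterval_antiderivative) (auto simp: continuous_on_eq_continuous_at)
  then show ?thesis
    using that by (auto simp: has_real_derivative_iff_has_vector_derivative)
qed

lemma surj_if_deriv_ge:
  fixes h :: "real \<Rightarrow> real"
  assumes der: "\<And>x. (h has_real_derivative \<phi> x) (at x)" and "0 < c" and ge: "\<And>x. c \<le> \<phi> x"
  shows "surj h"
proof -
  have inc: "c * (b - a) \<le> h b - h a" if "a \<le> b" for a b
  proof (cases "a = b")
    case False
    then have "a < b" using that by simp
    then obtain z where "h b - h a = (b - a) * \<phi> z"
      using MVT2[of a b h \<phi>] der by blast
    then show ?thesis using mult_left_mono[OF ge[of z], of "b - a"] that by (simp add: mult.commute)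
  qed simp
  have "\<exists>x. v = h x" for v
  proof -
    define r where "r = \<bar>v - h 0\<bar> / c"
    have r: "0 \<le> r" "c * r = \<bar>v - h 0\<bar>" using \<open>0 < c\<close> by (auto simp: r_def)
    then have "h (- r) \<le> v" "v \<le> h r" using inc[of 0 r] inc[of "- r" 0] by auto
    moreover have "continuous_on {- r..r} h"
      using der by (meson DERIV_continuous continuous_at_imp_continuous_on)
    ultimately show ?thesis using IVT'[of h "- r" v r] r(1) by auto
  qed
  then show ?thesis by (simp add: surj_def)
qed

text \<open>The primitive \<open>m\<close> vanishing at 0 is the map that moves the vertices in the
  shape change. Both signs are treated together, so \<open>m\<close> may reverse orientation and the
  estimates are stated for \<open>\<bar>\<mu> x\<bar>\<close>.\<close>

locale shape_changing_form =
  fixes T :: "'l tile set" and R :: real and \<mu> m :: "real \<Rightarrow> real"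
  assumes T: "tiling T" and R: "0 < R" and pe: "pattern_equivariant T R \<mu>"
    and cont: "continuous_on UNIV \<mu>"
    and sgn: "(\<forall>x. 0 < \<mu> x) \<or> (\<forall>x. \<mu> x < 0)"
    and der: "\<And>x. (m has_real_derivative \<mu> x) (at x)"
    and m_0: "m 0 = 0"
begin

section \<open>The primitive as a bi-Lipschitz bijection of the line\<close>

lemma compact_range_abs: "compact (range (\<lambda>x. \<bar>\<mu> x\<bar>))"
proof -
  have "compact ((\<lambda>y. \<bar>y\<bar>) ` range \<mu>)"
    using compact_range_pattern_equivariant[OF T less_imp_le[OF R] pe cont]
    by (intro compact_continuous_image[of "range \<mu>"] continuous_intros)
  then show ?thesis by (simp add: image_image)
qed

lemma form_lower_bound: obtains c where "0 < c" "\<And>x. c \<le> \<bar>\<mu> x\<bar>"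
proof -
  obtain z where "\<forall>y\<in>range (\<lambda>x. \<bar>\<mu> x\<bar>). \<bar>\<mu> z\<bar> \<le> y"
    using compact_attains_inf[OF compact_range_abs] by blast
  moreover have "0 < \<bar>\<mu> z\<bar>" using sgn by (metis less_irrefl zero_less_abs_iff)
  ultimately show ?thesis using that by blast
qed

lemma form_upper_bound: obtains C where "0 < C" "\<And>x. \<bar>\<mu> x\<bar> \<le> C"
proof -
  obtain z where "\<forall>y\<in>range (\<lambda>x. \<bar>\<mu> x\<bar>). y \<le> \<bar>\<mu> z\<bar>"
    using compact_attains_sup[OF compact_range_abs] by blast
  moreover have "0 < \<bar>\<mu> z\<bar>" using sgn by (metis less_irrefl zero_less_abs_iff)
  ultimately show ?thesis using that by blast
qed

lemma mean_value: "\<exists>z. m b - m a = (b - a) * \<mu> z"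
proof (rule linorder_cases[of a b])
  assume "a < b" then show ?thesis using MVT2[of a b m \<mu>] der by auto
next
  assume "b < a"
  then obtain z where "m a - m b = (a - b) * \<mu> z" using MVT2[of b a m \<mu>] der by auto
  then show ?thesis by (intro exI[of _ z]) (simp add: algebra_simps)
qed simp

lemma m_lower_bound:
  assumes "\<And>x. c \<le> \<bar>\<mu> x\<bar>" shows "c * \<bar>b - a\<bar> \<le> \<bar>m b - m a\<bar>"
  using mean_value[of b a] assms
  by (metis abs_ge_zero abs_mult mult.commute mult_right_mono)

lemma m_upper_bound:
  assumes "\<And>x. \<bar>\<mu> x\<bar> \<le> C" shows "\<bar>m b - m a\<bar> \<le> C * \<bar>b - a\<bar>"
  using mean_value[of b a] assms
  by (metis abs_ge_zero abs_mult mult.commute mult_right_mono)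

lemma inj_m: "inj m"
proof (rule injI)
  fix a b assume "m a = m b"
  then have "c * \<bar>b - a\<bar> \<le> 0" if "\<And>x. c \<le> \<bar>\<mu> x\<bar>" for c
    using m_lower_bound[OF that, of b a] by simp
  then show "a = b" using form_lower_bound
    by (metis abs_le_zero_iff eq_iff_diff_eq_0 linorder_not_le mult_le_0_iff)
qed

lemma surj_m: "surj m"
proof -
  obtain c where c: "0 < c" "\<And>x. c \<le> \<bar>\<mu> x\<bar>" using form_lower_bound by blast
  show ?thesis
  proof (cases "\<forall>x. 0 < \<mu> x")
    case True
    then have "c \<le> \<mu> x" for x using c(2)[of x] by (simp add: abs_of_pos)
    then show ?thesis using surj_if_deriv_ge[OF der c(1)] by blast
  next
    case False
    then have "\<mu> x < 0" for x using sgn by blast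
    then have "c \<le> - \<mu> x" for x using c(2)[of x] by (simp add: abs_of_neg)
    moreover have "((\<lambda>x. - m x) has_real_derivative - \<mu> x) (at x)" for x
      by (intro DERIV_minus der)
    ultimately have s: "surj (\<lambda>x. - m x)" by (rule surj_if_deriv_ge[OF _ c(1), rotated])
    have "\<exists>x. v = m x" for v
      using surjD[OF s, of "- v"] by auto
    then show ?thesis by (simp add: surj_def)
  qed
qed

text \<open>The coordinate, on the line of \<open>T\<close>, of a point of the reshaped
  line.\<close>

definition position :: "real \<Rightarrow> real" where "position = inv m"

lemma position_m [simp]: "position (m x) = x"
  unfolding position_def by (rule inv_f_f[OF inj_m])

lemma m_position [simp]: "m (position v) = v"
  unfolding position_def by (rule surj_f_inv_f[OF surj_m])

lemma form_nonzero: "\<mu> x \<noteq> 0"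
  using sgn by (metis less_irrefl)

lemma position_deriv: "(position has_real_derivative inverse (\<mu> (position v))) (at v)"
proof (rule DERIV_inverse_function[where f = m and a = "v - 1" and b = "v + 1"])
  show "(m has_real_derivative \<mu> (position v)) (at (position v))" by (rule der)
  obtain c where c: "0 < c" "\<And>x. c \<le> \<bar>\<mu> x\<bar>" using form_lower_bound by blast
  \<comment> \<open>The inverse function rule asks for continuity of the inverse, which the lower
    bound on \<open>\<bar>\<mu> x\<bar>\<close> supplies as a Lipschitz estimate.\<close>
  have "\<bar>position w - position v\<bar> \<le> inverse c * \<bar>w - v\<bar>" for w v
    using m_lower_bound[OF c(2), of "position w" "position v"] c(1)
    by (simp add: field_simps)
  then have "(inverse c)-lipschitz_on UNIV position"
    using c(1) by (intro lipschitz_onI) (auto simp: dist_real_def)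
  then show "isCont position v"
    using lipschitz_on_continuous_on continuous_on_eq_continuous_at by blast
qed (auto simp: form_nonzero)

section \<open>The reshaped tiling as the image of \<open>T\<close> under \<open>m\<close>\<close>

lemma continuous_on_m: "continuous_on S m"
  using der by (meson DERIV_continuous continuous_at_imp_continuous_on)

lemma m_image_segment: "m ` closed_segment a b = closed_segment (m a) (m b)"
  by (rule continuous_injective_image_segment_1[OF continuous_on_m inj_on_subset[OF inj_m]]) simp

lemma m_image_open_segment: "m ` open_segment a b = open_segment (m a) (m b)"
  by (rule continuous_injective_image_open_segment_1[OF continuous_on_m inj_on_subset[OF inj_m]]) simp

lemma m_image_tile: "t \<in> T \<Longrightarrow> m ` fst t = closed_segment (m (lo t)) (m (hi t))"
  using tile_interval[OF T, of t] closed_segment_eq_real_ivl1[of "lo t" "hi t"] m_image_segment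
  by (metis less_imp_le)

lemma reshaped_tiling_eq: "reshaped_tiling T R \<mu> = (\<lambda>t. (m ` fst t, collar T R t)) ` T"
proof -
  have "(LBINT x=0..ereal a. \<mu> x) = m a" for a
    using interval_integral_eq_diff[OF cont der, of 0 a] m_0 by (simp add: zero_ereal_def)
  then show ?thesis
    unfolding reshaped_tiling_def using m_image_tile by (intro image_cong) simp_all
qed

text \<open>Points at equal distance from the left ends of tiles with the same collar look alike out
  to radius \<open>R\<close>, so \<open>\<mu>\<close> agrees there and the difference of the
  translated primitives has derivative 0.\<close>

lemma increments_eq:
  assumes t: "t \<in> T" "u \<in> T" "collar T R t = collar T R u" and w: "0 \<le> w" "w \<le> hi t - lo t"
  shows "\<mu> (lo t + w) = \<mu> (lo u + w)" and "m (lo t + w) - m (lo t) = m (lo u + w) - m (lo u)"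
proof -
  have eq: "\<mu> (lo t + w) = \<mu> (lo u + w)" if "w \<in> {0..hi t - lo t}" for w
    using collar_eqD(3)[OF T less_imp_le[OF R] t, of w] pe that unfolding pattern_equivariant_def by simp
  then show "\<mu> (lo t + w) = \<mu> (lo u + w)" using w by simp
  define d where "d w = m (lo t + w) - m (lo u + w)" for w
  have "\<exists>c. \<forall>w\<in>{0..hi t - lo t}. d w = c"
  proof (rule has_field_derivative_zero_constant)
    fix w assume w: "w \<in> {0..hi t - lo t}"
    have *: "((\<lambda>w. m (a + w)) has_real_derivative \<mu> (a + w)) (at w)" for a
      using DERIV_shift[of m "\<mu> (a + w)" w a] der[of "a + w"] by (simp add: add.commute)
    have "(d has_real_derivative \<mu> (lo t + w) - \<mu> (lo u + w)) (at w)"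
      unfolding d_def by (intro DERIV_diff *)
    then show "(d has_real_derivative 0) (at w within {0..hi t - lo t})"
      using eq[OF w] has_field_derivative_at_within by fastforce
  qed simp
  then have "d w = d 0" using w by force
  then show "m (lo t + w) - m (lo t) = m (lo u + w) - m (lo u)" by (simp add: d_def)
qed

lemma tile_increments_eq:
  assumes "t \<in> T" "u \<in> T" "collar T R t = collar T R u"
  shows "m (hi t) - m (lo t) = m (hi u) - m (lo u)"
proof -
  have "hi t = lo t + (hi t - lo t)" "hi u = lo u + (hi t - lo t)"
    using collar_eqD(2)[OF T less_imp_le[OF R] assms] by simp_all
  then show ?thesis
    using increments_eq(2)[OF assms, of "hi t - lo t"] tile_interval(2)[OF T assms(1)] by simp
qed

lemma tile_length_segment: "tile_length (closed_segment a b, l) = \<bar>b - a\<bar>"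
  by (simp add: tile_length_def closed_segment_eq_real_ivl)

lemma tiling_reshaped: "tiling (reshaped_tiling T R \<mu>)"
  unfolding tiling_def reshaped_tiling_eq
proof (intro conjI)
  show "\<forall>t\<in>(\<lambda>t. (m ` fst t, collar T R t)) ` T. \<exists>a b. a < b \<and> fst t = {a..b}"
  proof (rule ballI, elim imageE)
    fix t' t assume t': "t' = (m ` fst t, collar T R t)" and t: "t \<in> T"
    have "m (lo t) \<noteq> m (hi t)"
      using tile_interval(2)[OF T t] injD[OF inj_m] by (metis less_irrefl)
    then show "\<exists>a b. a < b \<and> fst t' = {a..b}"
      unfolding t' fst_conv m_image_tile[OF t] closed_segment_eq_real_ivl
      by (metis linorder_not_le nless_le)
  qed
  have "snd ` (\<lambda>t. (m ` fst t, collar T R t)) ` T = collar T R ` T" by (simp add: image_image)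
  then show "finite (snd ` (\<lambda>t. (m ` fst t, collar T R t)) ` T)"
    using finite_collars[OF T less_imp_le[OF R]] by simp
  show "\<forall>t\<in>(\<lambda>t. (m ` fst t, collar T R t)) ` T. \<forall>u\<in>(\<lambda>t. (m ` fst t, collar T R t)) ` T.
    snd t = snd u \<longrightarrow> tile_length t = tile_length u"
  proof (intro ballI impI, elim imageE)
    fix t' u' t u assume t': "t' = (m ` fst t, collar T R t)" and t: "t \<in> T"
      and u': "u' = (m ` fst u, collar T R u)" and u: "u \<in> T" and "snd t' = snd u'"
    then have c: "collar T R t = collar T R u" by simp
    have "m (hi t) - m (lo t) = m (hi u) - m (lo u)"
      by (rule tile_increments_eq[OF t u c])
    then show "tile_length t' = tile_length u'"
      unfolding t' u' m_image_tile[OF t] m_image_tile[OF u] tile_length_segment by simp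
  qed
  show "\<forall>t\<in>(\<lambda>t. (m ` fst t, collar T R t)) ` T. \<forall>u\<in>(\<lambda>t. (m ` fst t, collar T R t)) ` T.
    t \<noteq> u \<longrightarrow> interior (fst t) \<inter> interior (fst u) = {}"
  proof (intro ballI impI, elim imageE)
    fix t' u' t u assume t': "t' = (m ` fst t, collar T R t)" and t: "t \<in> T"
      and u': "u' = (m ` fst u, collar T R u)" and u: "u \<in> T" and "t' \<noteq> u'"
    then have "t \<noteq> u" by blast
    then have disj: "{lo t<..<hi t} \<inter> {lo u<..<hi u} = {}"
      using tiles_ordered[OF T t u] by auto
    have int: "interior (m ` fst t) = m ` {lo t<..<hi t}" if t: "t \<in> T" for t
    proof -
      have "interior (closed_segment a b) = open_segment a b" for a b :: real
        by (simp add: closed_segment_eq_real_ivl open_segment_eq_real_ivl)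
      moreover have "{lo t<..<hi t} = open_segment (lo t) (hi t)"
        using tile_interval(2)[OF T t] by (simp add: open_segment_eq_real_ivl)
      ultimately show ?thesis by (simp only: m_image_tile[OF t] m_image_open_segment)
    qed
    show "interior (fst t') \<inter> interior (fst u') = {}"
      unfolding t' u' fst_conv int[OF t] int[OF u] image_Int[OF inj_m, symmetric] disj by simp
  qed
  have "(\<Union>t\<in>(\<lambda>t. (m ` fst t, collar T R t)) ` T. fst t) = m ` (\<Union>t\<in>T. fst t)" by auto
  then show "(\<Union>t\<in>(\<lambda>t. (m ` fst t, collar T R t)) ` T. fst t) = UNIV"
    using tilingD(5)[OF T] surj_m by simp
qed

text \<open>The labels of the reshaped tiling are collars of \<open>T\<close>. A tile shared around
  \<open>m x\<close> and \<open>m y\<close> therefore comes from a tile \<open>u\<close> of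
  \<open>T\<close> with the collar of \<open>t\<close>, and the point of \<open>u\<close>
  corresponding to \<open>z\<close> is displaced from \<open>m y\<close> as \<open>m z\<close> is
  from \<open>m x\<close>.\<close>

lemma matching_tile:
  assumes agree: "agree_on {- K..K} (shift (m x) (reshaped_tiling T R \<mu>)) (shift (m y) (reshaped_tiling T R \<mu>))"
    and t: "t \<in> T" "lo t \<le> z" "z \<le> hi t" and z: "\<bar>m z - m x\<bar> \<le> K"
  obtains u where "u \<in> T" "collar T R t = collar T R u"
    "\<mu> (lo u + (z - lo t)) = \<mu> z" "m (lo u + (z - lo t)) - m y = m z - m x"
proof -
  let ?r = "\<lambda>t. (m ` fst t, collar T R t)"
  have "z \<in> fst t" using tile_interval(1)[OF T t(1)] t(2,3) by (metis atLeastAtMost_iff)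
  then have "m z - m x \<in> fst (shift_tile (m x) (?r t))" by (simp add: shift_tile_def)
  moreover have "m z - m x \<in> {- K..K}" using z by (auto simp: abs_le_iff)
  moreover have "shift_tile (m x) (?r t) \<in> shift (m x) (reshaped_tiling T R \<mu>)"
    unfolding shift_def reshaped_tiling_eq using t(1) by blast
  ultimately have "shift_tile (m x) (?r t) \<in> patch {- K..K} (shift (m x) (reshaped_tiling T R \<mu>))"
    unfolding patch_def by blast
  then have "shift_tile (m x) (?r t) \<in> shift (m y) (reshaped_tiling T R \<mu>)"
    using agree unfolding agree_on_def patch_def by blast
  then obtain u where u: "u \<in> T" "shift_tile (m x) (?r t) = shift_tile (m y) (?r u)"
    unfolding shift_def reshaped_tiling_eq by blast
  then have c: "collar T R t = collar T R u" by (simp add: shift_tile_def)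
  note inc = increments_eq[OF t(1) u(1) c]
  have "(\<lambda>z. z - m x) ` closed_segment (m (lo t)) (m (hi t))
      = (\<lambda>z. z - m y) ` closed_segment (m (lo u)) (m (hi u))"
    using arg_cong[OF u(2), of fst] m_image_tile[OF t(1)] m_image_tile[OF u(1)]
    by (simp add: shift_tile_def)
  then have "closed_segment (m (lo t) - m x) (m (hi t) - m x)
      = closed_segment (m (lo u) - m y) (m (hi u) - m y)"
    by (simp add: closed_segment_eq_real_ivl image_diff_atLeastAtMost_real split: if_splits)
  \<comment> \<open>Equal segments alone do not tell which end is which; equal signed increments
    rule out that the ends are exchanged.\<close>
  moreover have "m (hi t) - m (lo t) = m (hi u) - m (lo u)"
    by (rule tile_increments_eq[OF t(1) u(1) c])
  ultimately have "m (lo t) - m x = m (lo u) - m y"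
    by (simp add: closed_segment_eq_real_ivl Icc_eq_Icc split: if_splits)
  then have "m (lo u + (z - lo t)) - m y = m z - m x"
    using inc(2)[of "z - lo t"] t(2,3) by simp
  moreover have "\<mu> (lo u + (z - lo t)) = \<mu> z" using inc(1)[of "z - lo t"] t(2,3) by simp
  ultimately show ?thesis using that u(1) c by blast
qed

text \<open>Corresponding points carry the same value of \<open>\<mu>\<close>, so both branches of
  the inverse map have the same derivative on the window. Their difference is constant, and at
  \<open>v = 0\<close> it is \<open>y - x\<close>.\<close>

lemma position_agree:
  assumes agree: "agree_on {- K..K} (shift (m x) (reshaped_tiling T R \<mu>)) (shift (m y) (reshaped_tiling T R \<mu>))"
    and v: "\<bar>v\<bar> \<le> K"
  shows "position (m y + v) - y = position (m x + v) - x"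
proof -
  define e where "e v = position (m y + v) - position (m x + v)" for v
  have "\<exists>c. \<forall>v\<in>{- K..K}. e v = c"
  proof (rule has_field_derivative_zero_constant)
    fix v assume v: "v \<in> {- K..K}"
    define z where "z = position (m x + v)"
    have z: "m z - m x = v" by (simp add: z_def)
    obtain t where t: "t \<in> T" "lo t \<le> z" "z \<le> hi t" using tiling_covers[OF T] .
    have zK: "\<bar>m z - m x\<bar> \<le> K" unfolding z using v by auto
    obtain u where u: "u \<in> T" "collar T R t = collar T R u"
        "\<mu> (lo u + (z - lo t)) = \<mu> z" "m (lo u + (z - lo t)) - m y = m z - m x"
      by (rule matching_tile[OF agree t zK])
    have "m y + v = m (lo u + (z - lo t))" using u(4) z by simp
    then have eq: "\<mu> (position (m y + v)) = \<mu> (position (m x + v))"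
      using u(3) by (simp add: z_def)
    have *: "((\<lambda>v. position (a + v)) has_real_derivative inverse (\<mu> (position (a + v)))) (at v)" for a
      using DERIV_shift[of position "inverse (\<mu> (position (a + v)))" v a] position_deriv[of "a + v"]
      by (simp add: add.commute)
    have "(e has_real_derivative
        inverse (\<mu> (position (m y + v))) - inverse (\<mu> (position (m x + v)))) (at v)"
      unfolding e_def by (intro DERIV_diff *)
    then show "(e has_real_derivative 0) (at v within {- K..K})"
      unfolding eq using has_field_derivative_at_within by fastforce
  qed simp
  then have "e v = e 0" using v by force
  then show ?thesis by (simp add: e_def)
qed

text \<open>Distance \<open>r\<close> in \<open>T\<close> becomes at most \<open>C * r\<close> on
  the reshaped line, so every tile in question has a matching tile; \<open>position_agree\<close>
  shows that the latter lies relative to \<open>y\<close> as the former does relative to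
  \<open>x\<close>.\<close>

lemma patch_subset_if_reshaped_agree:
  assumes agree: "agree_on {- K..K} (shift (m x) (reshaped_tiling T R \<mu>)) (shift (m y) (reshaped_tiling T R \<mu>))"
    and C: "\<And>x. \<bar>\<mu> x\<bar> \<le> C" and K: "C * r \<le> K"
  shows "patch {- r..r} (shift x T) \<subseteq> shift y T"
proof
  fix t' assume "t' \<in> patch {- r..r} (shift x T)"
  then have "t' \<in> shift_tile x ` T" "fst t' \<inter> {- r..r} \<noteq> {}" by (simp_all add: patch_def shift_def)
  then obtain t v where t': "t \<in> T" "t' = shift_tile x t" "v \<in> fst t'" "v \<in> {- r..r}" by blast
  then have v: "\<bar>v\<bar> \<le> r" by auto
  define z where "z = x + v"
  have "z \<in> fst t" using t'(2,3) by (auto simp: shift_tile_def z_def)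
  then have t: "lo t \<le> z" "z \<le> hi t"
    using tile_interval(1)[OF T t'(1)] by (metis atLeastAtMost_iff)+
  have "0 \<le> C" using C[of 0] by simp
  have "\<bar>m z - m x\<bar> \<le> C * \<bar>z - x\<bar>" by (rule m_upper_bound[OF C])
  also have "\<dots> \<le> K" using mult_left_mono[OF v \<open>0 \<le> C\<close>] K by (simp add: z_def)
  finally have zK: "\<bar>m z - m x\<bar> \<le> K" .
  obtain u where u: "u \<in> T" "collar T R t = collar T R u"
      "\<mu> (lo u + (z - lo t)) = \<mu> z" "m (lo u + (z - lo t)) - m y = m z - m x"
    by (rule matching_tile[OF agree t'(1) t zK])
  have "m y + (m z - m x) = m (lo u + (z - lo t))" using u(4) by simp
  then have "lo u + (z - lo t) - y = z - x"
    using position_agree[OF agree zK] by simp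
  then have "lo u - y = lo t - x" by simp
  moreover have "shift_tile (lo t) t = shift_tile (lo u) u"
    by (rule collar_eqD(1)[OF T less_imp_le[OF R] t'(1) u(1,2)])
  then have "shift_tile (x - lo t) (shift_tile (lo t) t) = shift_tile (x - lo t) (shift_tile (lo u) u)"
    by simp
  ultimately have "t' = shift_tile y u" unfolding t'(2) shift_tile_shift_tile by (simp add: algebra_simps)
  then show "t' \<in> shift y T" using u(1) by (simp add: shift_def)
qed

lemma agree_if_reshaped_agree:
  assumes agree: "agree_on {- K..K} (shift (m x) (reshaped_tiling T R \<mu>)) (shift (m y) (reshaped_tiling T R \<mu>))"
    and C: "\<And>x. \<bar>\<mu> x\<bar> \<le> C" and K: "C * r \<le> K"
  shows "agree_on {- r..r} (shift x T) (shift y T)"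
proof -
  have "patch {- r..r} (shift x T) \<subseteq> shift y T"
    by (rule patch_subset_if_reshaped_agree[OF agree C K])
  moreover have "patch {- r..r} (shift y T) \<subseteq> shift x T"
    by (rule patch_subset_if_reshaped_agree[OF _ C K]) (use agree in \<open>simp add: agree_on_def\<close>)
  ultimately show ?thesis unfolding agree_on_def patch_def by blast
qed

end

section \<open>The tiling metric, orbit closures and non-periodicity\<close>

lemma topspace_tilings_topology: "topspace tilings_topology = {T. tiling T}"
  unfolding tilings_topology_def by (rule Metric_space.topspace_mtopology[OF Metric_space_tilings])

lemma closure_of_tilings:
  assumes "S \<subseteq> {T. tiling T}"
  shows "tilings_topology closure_of S = {U. tiling U \<and> (\<forall>e>0. \<exists>V\<in>S. tiling_dist U V < e)}"
  unfolding tilings_topology_def Metric_space.metric_closure_of[OF Metric_space_tilings]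
    Metric_space.in_mball[OF Metric_space_tilings]
  using assms by blast

lemma mem_orbit_closure_iff:
  assumes "tiling T"
  shows "U \<in> orbit_closure T \<longleftrightarrow> tiling U \<and> (\<forall>e>0. \<exists>s. tiling_dist U (shift s T) < e)"
proof -
  have "range (\<lambda>s. shift s T) \<subseteq> {T. tiling T}" using tiling_shift[OF assms] by blast
  then show ?thesis unfolding orbit_closure_def by (subst closure_of_tilings) simp_all
qed

lemma shift_mem_orbit_closure:
  assumes "tiling T" shows "shift s T \<in> orbit_closure T"
  unfolding mem_orbit_closure_iff[OF assms]
  using tiling_shift[OF assms] tiling_dist_self by metis

text \<open>Closeness in the metric allows small translations of both tilings. Undoing the second
  one leaves a single translation, at the price of some radius.\<close>

lemma tiling_dist_agree:
  assumes "0 \<le> K" "0 < \<eta>"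
  obtains e where "0 < e"
    "\<And>U V. tiling_dist U V < e \<Longrightarrow> \<exists>\<sigma>. \<bar>\<sigma>\<bar> \<le> \<eta> \<and> agree_on {- K..K} (shift \<sigma> U) V"
proof -
  \<comment> \<open>The last term makes \<open>1 / e\<close> at least \<open>K + 1\<close>; the
    extra unit pays for undoing \<open>s2\<close>.\<close>
  define e where "e = min \<eta> (min 1 (1 / (K + 1)))"
  have le: "0 < e" "e \<le> \<eta>" "e \<le> 1" "e \<le> 1 / (K + 1)" using assms unfolding e_def by (auto simp: min_le_iff_disj)
  have "1 / (1 / (K + 1)) \<le> 1 / e" using le(4) by (rule divide_left_mono) (use assms le in auto)
  then have K: "K + 1 \<le> 1 / e" by simp
  have "\<exists>\<sigma>. \<bar>\<sigma>\<bar> \<le> \<eta> \<and> agree_on {- K..K} (shift \<sigma> U) V"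
    if d: "tiling_dist U V < e" for U V :: "'l tile set"
  proof -
    obtain s1 s2 where s: "\<bar>s1\<bar> \<le> e / 2" "\<bar>s2\<bar> \<le> e / 2"
        "agree_on {- (1 / e)..1 / e} (shift s1 U) (shift s2 V)"
      using tiling_dist_lessD[OF d le(3)] unfolding tilings_close_def by blast
    have s2: "\<bar>s2\<bar> \<le> 1" using s(2) le(3) by linarith
    have "{- K..K} \<subseteq> (\<lambda>x. x - (- s2)) ` {- (1 / e)..1 / e}"
      unfolding image_diff_atLeastAtMost_real atLeastatMost_subset_iff using K s2 by linarith
    then have "agree_on {- K..K} (shift (- s2) (shift s1 U)) (shift (- s2) (shift s2 V))"
      by (rule agree_on_mono[OF agree_on_shift[OF s(3)]])
    then have "agree_on {- K..K} (shift (s1 - s2) U) V" by (simp add: shift_shift)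
    moreover have "\<bar>s1 - s2\<bar> \<le> \<eta>" using s(1,2) le(2) by linarith
    ultimately show ?thesis by blast
  qed
  then show thesis using that le(1) by blast
qed

lemma tiling_dist_shift_le: "tiling_dist (shift x T) (shift y T) \<le> \<bar>x - y\<bar>"
proof (cases "x = y")
  case False
  \<comment> \<open>Half of the translation on each side turns both tilings into the one based at
    the midpoint.\<close>
  have "shift ((y - x) / 2) (shift x T) = shift ((x - y) / 2) (shift y T)"
    by (simp add: shift_shift field_simps)
  then have "tilings_close \<bar>x - y\<bar> (shift x T) (shift y T)"
    unfolding tilings_close_def agree_on_def
    by (intro exI[of _ "(y - x) / 2"] exI[of _ "(x - y) / 2"]) (simp add: abs_minus_commute)
  then show ?thesis using False by (intro tiling_dist_le) auto
qed (simp add: tiling_dist_self)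

lemma orbit_closure_shift:
  assumes T: "tiling T" and U: "U \<in> orbit_closure T"
  shows "shift x U \<in> orbit_closure T"
  unfolding mem_orbit_closure_iff[OF T]
proof (intro conjI allI impI)
  show "tiling (shift x U)" using U tiling_shift unfolding mem_orbit_closure_iff[OF T] by blast
  fix e :: real assume "0 < e"
  \<comment> \<open>Translating by \<open>x\<close> costs \<open>\<bar>x\<bar>\<close> of radius;
    what remains is the radius that closeness \<open>e / 2\<close> demands.\<close>
  define K where "K = 1 / (e / 2) + \<bar>x\<bar>"
  have "0 \<le> K" "0 < e / 4" using \<open>0 < e\<close> by (auto simp: K_def)
  then obtain e' where e': "0 < e'"
      "\<And>U V. tiling_dist U V < e' \<Longrightarrow> \<exists>\<sigma>. \<bar>\<sigma>\<bar> \<le> e / 4 \<and> agree_on {- K..K} (shift \<sigma> U) (V :: 'a tile set)"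
    using tiling_dist_agree by metis
  obtain s where "tiling_dist U (shift s T) < e'"
    using U e'(1) unfolding mem_orbit_closure_iff[OF T] by blast
  then obtain \<sigma> where \<sigma>: "\<bar>\<sigma>\<bar> \<le> e / 4" "agree_on {- K..K} (shift \<sigma> U) (shift s T)"
    using e'(2) by blast
  have "{- (1 / (e / 2))..1 / (e / 2)} \<subseteq> (\<lambda>z. z - x) ` {- K..K}"
    unfolding image_diff_atLeastAtMost_real K_def by auto
  then have "agree_on {- (1 / (e / 2))..1 / (e / 2)} (shift x (shift \<sigma> U)) (shift x (shift s T))"
    by (rule agree_on_mono[OF agree_on_shift[OF \<sigma>(2)]])
  then have "tilings_close (e / 2) (shift x U) (shift (x + s) T)"
    unfolding tilings_close_def using \<sigma>(1) \<open>0 < e\<close>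
    by (intro exI[of _ \<sigma>] exI[of _ 0]) (simp add: shift_shift add.commute)
  then have "tiling_dist (shift x U) (shift (x + s) T) \<le> e / 2"
    using \<open>0 < e\<close> by (intro tiling_dist_le) auto
  then show "\<exists>s. tiling_dist (shift x U) (shift s T) < e"
    using \<open>0 < e\<close> by (intro exI[of _ "x + s"]) simp
qed

text \<open>A period of a tiling in the hull is, by repetitivity, a period of every patch of \<open>T\<close>.\<close>

lemma nonperiodic_orbit_closure:
  assumes T: "tiling T" and rep: "repetitive T" and np: "nonperiodic T" and U: "U \<in> orbit_closure T"
  shows "nonperiodic U"
  unfolding nonperiodic_def
proof (intro allI impI notI)
  fix s :: real assume "s \<noteq> 0" and per: "shift s U = U"
  have tU: "tiling U" using U unfolding mem_orbit_closure_iff[OF T] by blast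
  have claim: "shift_tile r t \<in> T" if per: "shift r U = U" and t: "t \<in> T" for r t
  proof -
    \<comment> \<open>The margin \<open>\<bar>r\<bar>\<close> puts into \<open>P\<close> also the
      tile of \<open>T\<close> over the midpoint of the translated \<open>t\<close>.\<close>
    define P where "P = patch {lo t - \<bar>r\<bar>..hi t + \<bar>r\<bar>} T"
    have PT: "P \<subseteq> T" by (auto simp: P_def patch_def)
    have lt: "lo t < hi t" by (rule tile_interval(2)[OF T t])
    have fin: "finite P" unfolding P_def by (rule finite_patch[OF T])
    have "\<exists>L>0. \<forall>a. \<exists>q. shift q P \<subseteq> T \<and> (\<Union>t\<in>shift q P. fst t) \<subseteq> {a..a + L}"
      by (rule rep[unfolded repetitive_def, rule_format, OF conjI[OF fin PT]])
    then obtain L where L: "0 < L" "\<forall>a. \<exists>q. shift q P \<subseteq> T \<and> (\<Union>t\<in>shift q P. fst t) \<subseteq> {a..a + L}"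
      by (elim exE conjE) (rule that)
    obtain e where e: "0 < e"
        "\<And>U V. tiling_dist U V < e \<Longrightarrow> \<exists>\<sigma>. \<bar>\<sigma>\<bar> \<le> 1 \<and> agree_on {- L..L} (shift \<sigma> U) (V :: 'a tile set)"
      using tiling_dist_agree[of L 1] L(1) by (metis less_imp_le zero_less_one)
    obtain x where "tiling_dist U (shift x T) < e"
      using U e(1) unfolding mem_orbit_closure_iff[OF T] by blast
    then obtain \<sigma> where \<sigma>: "agree_on {- L..L} (shift \<sigma> U) (shift x T)" using e(2) by blast
    \<comment> \<open>This copy of \<open>P\<close> lies in the window around \<open>x\<close> where
      \<open>T\<close> matches a translate of \<open>U\<close>, so \<open>P\<close> occurs in
      \<open>U\<close> as well, where the period \<open>r\<close> can be applied.\<close>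
    obtain q where q: "shift q P \<subseteq> T" "(\<Union>t\<in>shift q P. fst t) \<subseteq> {x..x + L}" using L(2) by blast
    define w where "w = x + q - \<sigma>"
    have wP: "shift_tile w p \<in> U" if p: "p \<in> P" for p
    proof -
      let ?p = "shift_tile q p"
      have 1: "?p \<in> shift q P" using p by (simp add: shift_def)
      then have pT: "?p \<in> T" using q(1) by blast
      have "lo ?p \<in> fst ?p"
        using tile_interval[OF T pT] by (metis atLeastAtMost_iff less_imp_le order_refl)
      then have "lo ?p \<in> {x..x + L}" using q(2) 1 by blast
      moreover have "lo ?p - x \<in> fst (shift_tile x ?p)"
        using \<open>lo ?p \<in> fst ?p\<close> by (simp add: shift_tile_def)
      ultimately have "fst (shift_tile x ?p) \<inter> {- L..L} \<noteq> {}" using L(1) by fastforce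
      moreover have "shift_tile x ?p \<in> shift x T" using pT by (simp add: shift_def)
      ultimately have "shift_tile x ?p \<in> patch {- L..L} (shift x T)" by (simp add: patch_def)
      then have "shift_tile x ?p \<in> shift \<sigma> U" using \<sigma> unfolding agree_on_def patch_def by blast
      then show ?thesis by (simp add: mem_shift_iff shift_tile_shift_tile w_def algebra_simps)
    qed
    have "t \<in> P" unfolding P_def using mem_patch_iff[OF T t] lt by auto
    then have "shift_tile w t \<in> U" by (rule wP)
    then have "shift_tile r (shift_tile w t) \<in> shift r U" by (simp add: shift_def)
    then have A: "shift_tile (r + w) t \<in> U" by (simp add: per shift_tile_shift_tile)
    \<comment> \<open>The midpoint of the translated \<open>t\<close>. Moved by \<open>w\<close>,
      both the tile \<open>p\<close> over \<open>z\<close> and the translate of \<open>t\<close>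
      belong to \<open>U\<close>; they overlap at \<open>z - w\<close>, hence coincide.\<close>
    define z where "z = (lo t + hi t) / 2 - r"
    obtain p where p: "p \<in> T" "lo p \<le> z" "z \<le> hi p" using tiling_covers[OF T] .
    have z: "lo t - r < z" "z < hi t - r" using lt by (auto simp: z_def field_simps)
    then have "p \<in> P" unfolding P_def using mem_patch_iff[OF T p(1)] lt p(2,3) by auto
    then have B: "shift_tile w p \<in> U" by (rule wP)
    have "shift_tile w p = shift_tile (r + w) t"
      by (rule tile_eqI[OF tU B A, of "z - w"])
        (use p z in \<open>simp_all add: lo_shift_tile[OF T] hi_shift_tile[OF T] t\<close>)
    from arg_cong[OF this, of "shift_tile (- w)"] have "p = shift_tile r t"
      by (simp add: shift_tile_shift_tile)
    then show ?thesis using p(1) by simp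
  qed
  have per': "shift (- s) U = U"
    using arg_cong[OF per, of "shift (- s)"] by (simp add: shift_shift)
  have "shift s T = T"
  proof
    show "shift s T \<subseteq> T" using claim[OF per] by (auto simp: shift_def)
    show "T \<subseteq> shift s T" using claim[OF per'] by (auto simp: mem_shift_iff)
  qed
  then show False using np \<open>s \<noteq> 0\<close> by (auto simp: nonperiodic_def)
qed

lemma nonperiodic_shift_inj:
  assumes "nonperiodic T" "shift a T = shift b T" shows "a = b"
proof (rule ccontr)
  assume "a \<noteq> b"
  have "shift (a - b) T = shift (- b) (shift a T)" by (simp add: shift_shift)
  also have "\<dots> = T" by (simp add: assms(2) shift_shift)
  finally show False using assms(1) \<open>a \<noteq> b\<close> by (simp add: nonperiodic_def)
qed

lemma continuous_map_shift:
  assumes T: "tiling T" and \<Omega>: "\<And>x. shift x T \<in> \<Omega>"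
  shows "continuous_map euclideanreal (space_topology \<Omega>) (\<lambda>x. shift x T)"
  unfolding space_topology_def continuous_map_in_subtopology
proof
  show "(\<lambda>x. shift x T) \<in> topspace euclideanreal \<rightarrow> \<Omega>" using \<Omega> by blast
  show "continuous_map euclideanreal tilings_topology (\<lambda>x. shift x T)"
    unfolding continuous_map
  proof (intro conjI allI impI)
    show "(\<lambda>x. shift x T) ` topspace euclideanreal \<subseteq> topspace tilings_topology"
      using tiling_shift[OF T] by (auto simp: topspace_tilings_topology)
    fix U :: "'a tile set set" assume U: "openin tilings_topology U"
    have "open {x. shift x T \<in> U}"
      unfolding open_dist
    proof
      fix x assume "x \<in> {x. shift x T \<in> U}"
      then obtain r where r: "0 < r" "Metric_space.mball {T. tiling T} tiling_dist (shift x T) r \<subseteq> U"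
        using U unfolding tilings_topology_def Metric_space.openin_mtopology[OF Metric_space_tilings] by blast
      have "shift y T \<in> U" if "dist y x < r" for y
      proof -
        have "tiling_dist (shift x T) (shift y T) < r"
          using tiling_dist_shift_le[of x T y] that by (simp add: dist_real_def abs_minus_commute)
        then have "shift y T \<in> Metric_space.mball {T. tiling T} tiling_dist (shift x T) r"
          using tiling_shift[OF T] by (simp add: Metric_space.in_mball[OF Metric_space_tilings])
        then show ?thesis using r(2) by blast
      qed
      then show "\<exists>e>0. \<forall>y. dist y x < e \<longrightarrow> y \<in> {x. shift x T \<in> U}" using r(1) by blast
    qed
    then show "openin euclideanreal {x \<in> topspace euclideanreal. shift x T \<in> U}" by simp
  qed
qed

section \<open>Returns supplied by the unit translation\<close>

context shape_changing_form begin

text \<open>By minimality, integer translates of the reshaped tiling based at \<open>s\<close>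
  approach the one based at \<open>m x\<close>. Carried back to \<open>T\<close>, they give returns
  of \<open>x\<close> whose \<open>m\<close>-value is close to \<open>s\<close> modulo 1.\<close>

lemma return_dense:
  assumes min: "minimal_under_unit_shift (shape_change T R \<mu>)" and "0 < \<delta>" "0 \<le> r"
  obtains y n where "agree_on {- r..r} (shift x T) (shift y T)" "\<bar>m y - (of_int n + s)\<bar> \<le> \<delta>"
proof -
  let ?T' = "reshaped_tiling T R \<mu>" and ?\<Omega> = "shape_change T R \<mu>"
  obtain C where C: "0 < C" "\<And>x. \<bar>\<mu> x\<bar> \<le> C" using form_upper_bound by blast
  have "0 \<le> C * r" using C(1) assms(3) by simp
  then obtain e where e: "0 < e" "\<And>U V. tiling_dist U V < e \<Longrightarrow>
      \<exists>\<sigma>. \<bar>\<sigma>\<bar> \<le> \<delta> \<and> agree_on {- (C * r)..C * r} (shift \<sigma> U) (V :: 'l tile set tile set)"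
    using tiling_dist_agree[OF _ assms(2)] by metis
  have mem: "shift a ?T' \<in> ?\<Omega>" for a
    unfolding shape_change_def by (rule shift_mem_orbit_closure[OF tiling_reshaped])
  have cl: "space_topology ?\<Omega> closure_of (range (\<lambda>n::int. shift (of_int n) (shift s ?T'))) = ?\<Omega>"
    by (rule bspec[OF min[unfolded minimal_under_unit_shift_def] mem[of s]])
  have "shift (m x) ?T' \<in> space_topology ?\<Omega> closure_of (range (\<lambda>n::int. shift (of_int n) (shift s ?T')))"
    unfolding cl by (rule mem)
  then have "shift (m x) ?T' \<in> tilings_topology closure_of (range (\<lambda>n::int. shift (of_int n) (shift s ?T')))"
    unfolding space_topology_def by (rule subsetD[OF closure_of_subtopology_subset])
  moreover have "range (\<lambda>n::int. shift (of_int n) (shift s ?T')) \<subseteq> {T. tiling T}"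
    by (intro image_subsetI CollectI tiling_shift tiling_reshaped)
  ultimately obtain n :: int where "tiling_dist (shift (m x) ?T') (shift (of_int n) (shift s ?T')) < e"
    using e(1) closure_of_tilings by blast
  then have "tiling_dist (shift (of_int n + s) ?T') (shift (m x) ?T') < e"
    by (simp add: tiling_dist_commute shift_shift)
  then obtain \<sigma> where \<sigma>: "\<bar>\<sigma>\<bar> \<le> \<delta>"
      "agree_on {- (C * r)..C * r} (shift (\<sigma> + (of_int n + s)) ?T') (shift (m x) ?T')"
    using e(2) by (metis shift_shift)
  \<comment> \<open>The correction \<open>\<sigma>\<close> is absorbed into the base point: the
    agreement becomes exact, and only the location is off by at most
    \<open>\<delta>\<close>.\<close>
  define y where "y = position (\<sigma> + (of_int n + s))"
  have "agree_on {- (C * r)..C * r} (shift (m x) ?T') (shift (m y) ?T')"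
    using \<sigma>(2) by (simp add: y_def agree_on_def)
  then have "agree_on {- r..r} (shift x T) (shift y T)"
    by (rule agree_if_reshaped_agree[OF _ C(2)]) simp
  moreover have "\<bar>m y - (of_int n + s)\<bar> \<le> \<delta>" using \<sigma>(1) by (simp add: y_def)
  ultimately show ?thesis using that by blast
qed

end

section \<open>Orbit maps and their iterates\<close>

text \<open>Non-periodicity makes the translation amount unique, so the orbit map is
  \<open>x\<close> plus the displacement at \<open>shift x T\<close>. Its continuity is what the
  intermediate value theorem needs when the direction of motion is determined.\<close>

lemma continuous_orbit_map:
  assumes T: "tiling T" "nonperiodic T" and \<Omega>: "\<And>x. shift x T \<in> \<Omega>"
    and F: "F \<in> displacement_homeos \<Omega>"
  shows "continuous_on UNIV (orbit_map F T)"
proof -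
  have "\<exists>\<Phi>. sPE_on_space \<Omega> \<Phi> \<and> (\<forall>T\<in>\<Omega>. F T = shift (\<Phi> T) T)"
    using F unfolding displacement_homeos_def mem_Collect_eq by (elim conjE)
  then obtain \<Phi> where "sPE_on_space \<Omega> \<Phi>" and disp: "\<forall>T\<in>\<Omega>. F T = shift (\<Phi> T) T"
    by (elim exE conjE) (rule that)
  then have "continuous_map (space_topology \<Omega>) euclideanreal \<Phi>"
    unfolding sPE_on_space_def by (elim conjE)
  then have "continuous_map euclideanreal euclideanreal (\<Phi> \<circ> (\<lambda>x. shift x T))"
    by (rule continuous_map_compose[OF continuous_map_shift[OF T(1) \<Omega>]])
  then have cont: "continuous_on UNIV (\<lambda>x. \<Phi> (shift x T))" by (simp add: comp_def)
  have "orbit_map F T x = \<Phi> (shift x T) + x" for x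
    unfolding orbit_map_def
  proof (rule the_equality)
    show eq: "F (shift x T) = shift (\<Phi> (shift x T) + x) T"
      using bspec[OF disp \<Omega>] by (simp only: shift_shift)
    show "y = \<Phi> (shift x T) + x" if "F (shift x T) = shift y T" for y
      using that[unfolded eq] nonperiodic_shift_inj[OF T(2)] by metis
  qed
  then have "orbit_map F T = (\<lambda>x. \<Phi> (shift x T) + x)" by blast
  then show ?thesis using cont by (simp add: continuous_on_add)
qed

section \<open>Integer iterates of a map of the line\<close>

lemma int_iterate_Suc: "0 \<le> n \<Longrightarrow> int_iterate f (n + 1) x = f (int_iterate f n x)"
  by (simp add: int_iterate_def nat_add_distrib)

lemma int_iterate_neg_Suc:
  assumes "n < 0" shows "int_iterate f n x = inv f (int_iterate f (n + 1) x)"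
proof -
  have "nat (- n) = Suc (nat (- (n + 1)))" using assms by linarith
  then show ?thesis using assms by (auto simp: int_iterate_def)
qed

lemma int_less_by_steps:
  fixes P :: "int \<Rightarrow> int \<Rightarrow> bool"
  assumes step: "\<And>n. P n (n + 1)" and trans: "\<And>a b c. P a b \<Longrightarrow> P b c \<Longrightarrow> P a c"
    and "m < n"
  shows "P m n"
  using \<open>m < n\<close>
proof (induction rule: int_gr_induct)
  case base then show ?case by (rule step)
next
  case (step i) then show ?case using assms(1,2) by blast
qed

text \<open>The hypothesis is the defining property of a rotation form for equal base points,
  where the integral vanishes.\<close>

lemma int_iterate_monotone:
  fixes f :: "real \<Rightarrow> real"
  assumes cont: "continuous_on UNIV f"
    and btw: "\<And>x. strictly_between (int_iterate f (- 1) x) x (int_iterate f 1 x)"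
  shows "(\<forall>x m n. m < n \<longrightarrow> int_iterate f m x < int_iterate f n x) \<or>
         (\<forall>x m n. m < n \<longrightarrow> int_iterate f n x < int_iterate f m x)"
proof -
  have btw: "(inv f x < x \<and> x < f x) \<or> (f x < x \<and> x < inv f x)" for x
    using btw[of x] by (simp add: int_iterate_def strictly_between_def)
  have c: "continuous_on {a..b} (\<lambda>x. f x - x)" for a b
    by (intro continuous_intros continuous_on_subset[OF cont]) simp
  have ne: "f x - x \<noteq> 0" for x using btw[of x] by auto
  \<comment> \<open>A change of sign of \<open>f x - x\<close> would force a fixed point, which
    betweenness excludes.\<close>
  have no: False if "(f a < a \<and> b < f b) \<or> (a < f a \<and> f b < b)" "a \<le> b" for a b
    using that IVT'[of "\<lambda>x. f x - x" a 0 b, OF _ _ _ c] IVT2'[of "\<lambda>x. f x - x" b 0 a, OF _ _ _ c] ne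
    by fastforce
  have "(\<forall>x. x < f x) \<or> (\<forall>x. f x < x)"
  proof (rule ccontr)
    assume "\<not> ?thesis"
    then obtain a b where "f a < a" "b < f b" using btw by (metis less_asym)
    then show False using no[of a b] no[of b a] by (cases "a \<le> b") auto
  qed
  then show ?thesis
  proof
    assume f: "\<forall>x. x < f x"
    then have "inv f x < x" for x using btw[of x] by (meson less_asym)
    then have "int_iterate f n x < int_iterate f (n + 1) x" for n x
      using f int_iterate_Suc[of n f x] int_iterate_neg_Suc[of n f x] by (cases "0 \<le> n") auto
    then have "m < n \<longrightarrow> int_iterate f m x < int_iterate f n x" for m n x
      using int_less_by_steps[of "\<lambda>m n. int_iterate f m x < int_iterate f n x" m n] by auto
    then show ?thesis by blast
  next
    assume f: "\<forall>x. f x < x"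
    then have "x < inv f x" for x using btw[of x] by (meson less_asym)
    then have "int_iterate f (n + 1) x < int_iterate f n x" for n x
      using f int_iterate_Suc[of n f x] int_iterate_neg_Suc[of n f x] by (cases "0 \<le> n") auto
    then have "m < n \<longrightarrow> int_iterate f n x < int_iterate f m x" for m n x
      using int_less_by_steps[of "\<lambda>m n. int_iterate f n x < int_iterate f m x" m n] by auto
    then show ?thesis by blast
  qed
qed

text \<open>If \<open>n\<close> separated \<open>a\<close> from \<open>b\<close>, then
  \<open>y\<close> would lie between the iterates \<open>m\<close> and \<open>n\<close> of
  \<open>x\<close> and also between the iterates \<open>n\<close> and \<open>k\<close>, with
  \<open>m < n < k\<close>. By monotonicity these open intervals are disjoint.\<close>

lemma no_integer_between:
  fixes f :: "real \<Rightarrow> real" and a b :: real and n :: int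
  assumes mono: "(\<forall>x m n. m < n \<longrightarrow> int_iterate f m x < int_iterate f n x) \<or>
         (\<forall>x m n. m < n \<longrightarrow> int_iterate f n x < int_iterate f m x)"
    and a: "\<And>m n. of_int m < a \<Longrightarrow> a < of_int n \<Longrightarrow>
        strictly_between (int_iterate f m x) y (int_iterate f n x)"
    and b: "\<And>m n. of_int m < b \<Longrightarrow> b < of_int n \<Longrightarrow>
        strictly_between (int_iterate f m x) y (int_iterate f n x)"
  shows "\<not> (a < of_int n \<and> of_int n < b)"
proof
  assume n: "a < of_int n \<and> of_int n < b"
  obtain m :: int where m: "of_int m < a" using ex_of_int_less by blast
  obtain k :: int where k: "b < of_int k" using ex_less_of_int by blast
  have "real_of_int m < of_int n" "real_of_int n < of_int k" using m k n by linarith+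
  then have "m < n" "n < k" by simp_all
  have "strictly_between (int_iterate f m x) y (int_iterate f n x)"
    using a m n by blast
  moreover have "strictly_between (int_iterate f n x) y (int_iterate f k x)"
    using b k n by blast
  moreover have "(int_iterate f m x < int_iterate f n x \<and> int_iterate f n x < int_iterate f k x) \<or>
      (int_iterate f n x < int_iterate f m x \<and> int_iterate f k x < int_iterate f n x)"
    using mono \<open>m < n\<close> \<open>n < k\<close> by blast
  ultimately show False unfolding strictly_between_def by linarith
qed

section \<open>Increments of pattern equivariant forms\<close>

lemma agree_on_translate:
  assumes "agree_on {- K..K} (shift x T) (shift y T)" and "\<bar>w\<bar> + r \<le> K"
  shows "agree_on {- r..r} (shift (x + w) T) (shift (y + w) T)"
proof -
  have "{- r..r} \<subseteq> (\<lambda>z. z - w) ` {- K..K}"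
    unfolding image_diff_atLeastAtMost_real using assms(2) by auto
  then have "agree_on {- r..r} (shift w (shift x T)) (shift w (shift y T))"
    by (rule agree_on_mono[OF agree_on_shift[OF assms(1)]])
  then show ?thesis by (simp add: shift_shift add.commute)
qed

lemma agree_on_trans: "agree_on A T U \<Longrightarrow> agree_on A U V \<Longrightarrow> agree_on A T V"
  by (simp add: agree_on_def)

lemma agree_on_radius_mono:
  "agree_on {- K..K} T U \<Longrightarrow> r \<le> K \<Longrightarrow> agree_on {- r..r} T U" for r K :: real
  by (rule agree_on_mono) auto

text \<open>As long as the \<open>r\<close>-balls around \<open>x + v\<close> and
  \<open>y + v\<close> stay in the region of agreement, \<open>h (x + v) - h (y + v)\<close> has
  derivative 0 in \<open>v\<close>.\<close>

lemma pattern_equivariant_increment: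
  assumes pe: "pattern_equivariant T r \<rho>" and der: "\<And>x. (h has_real_derivative \<rho> x) (at x)"
    and agree: "agree_on {- K..K} (shift x T) (shift y T)" and K: "\<bar>w\<bar> + r \<le> K"
  shows "h (x + w) - h x = h (y + w) - h y"
proof -
  define d where "d v = h (x + v) - h (y + v)" for v
  have "\<exists>c. \<forall>v\<in>{- \<bar>w\<bar>..\<bar>w\<bar>}. d v = c"
  proof (rule has_field_derivative_zero_constant)
    fix v assume "v \<in> {- \<bar>w\<bar>..\<bar>w\<bar>}"
    then have "\<bar>v\<bar> + r \<le> K" using K by auto
    then have eq: "\<rho> (x + v) = \<rho> (y + v)"
      using agree_on_translate[OF agree] pe unfolding pattern_equivariant_def by blast
    have *: "((\<lambda>v. h (a + v)) has_real_derivative \<rho> (a + v)) (at v)" for a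
      using DERIV_shift[of h "\<rho> (a + v)" v a] der[of "a + v"] by (simp add: add.commute)
    have "(d has_real_derivative \<rho> (x + v) - \<rho> (y + v)) (at v)"
      unfolding d_def by (intro DERIV_diff *)
    then show "(d has_real_derivative 0) (at v within {- \<bar>w\<bar>..\<bar>w\<bar>})"
      unfolding eq using has_field_derivative_at_within by fastforce
  qed simp
  moreover have "w \<in> {- \<bar>w\<bar>..\<bar>w\<bar>}" "0 \<in> {- \<bar>w\<bar>..\<bar>w\<bar>}" by auto
  ultimately have "d w = d 0" by metis
  then show ?thesis by (simp add: d_def)
qed

text \<open>One half of the Gottschalk--Hedlund argument: a return path from \<open>x\<close> to a near-minimizer
  of \<open>h\<close> can be repeated from every return \<open>y\<close> of \<open>x\<close> that agrees on a large enough ball.\<close>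

lemma return_increment_lower_bound:
  assumes pe: "pattern_equivariant T r \<rho>" and der: "\<And>x. (h has_real_derivative \<rho> x) (at x)"
    and bound: "\<And>y. agree_on {- R..R} (shift x T) (shift y T) \<Longrightarrow> \<bar>h y - h x\<bar> \<le> B"
    and "0 < \<epsilon>"
  obtains K where "\<And>y. agree_on {- K..K} (shift x T) (shift y T) \<Longrightarrow> - \<epsilon> \<le> h y - h x"
proof -
  define Y where "Y = {y. agree_on {- R..R} (shift x T) (shift y T)}"
  define s where "s = Inf ((\<lambda>y. h y - h x) ` Y)"
  have bdd: "bdd_below ((\<lambda>y. h y - h x) ` Y)"
    by (rule bdd_belowI[of _ "- B"]) (use bound in \<open>force simp: Y_def abs_le_iff\<close>)
  have "x \<in> Y" by (simp add: Y_def agree_on_def)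
  then have "(\<lambda>y. h y - h x) ` Y \<noteq> {}" by blast
  moreover have "s < s + \<epsilon>" using \<open>0 < \<epsilon>\<close> by simp
  ultimately obtain z where z: "z \<in> Y" "h z - h x < s + \<epsilon>"
    unfolding s_def using cInf_less_iff[OF _ bdd] by blast
  define w where "w = z - x"
  \<comment> \<open>The region of agreement must contain the \<open>r\<close>-balls along the path
    of length \<open>\<bar>w\<bar>\<close> and the \<open>R\<close>-ball at its end.\<close>
  define K where "K = \<bar>w\<bar> + max r R"
  have "- \<epsilon> \<le> h y - h x" if y: "agree_on {- K..K} (shift x T) (shift y T)" for y
  proof -
    have "agree_on {- R..R} (shift (x + w) T) (shift (y + w) T)"
      by (rule agree_on_translate[OF y]) (simp add: K_def)
    \<comment> \<open>The point \<open>y + w\<close> looks like \<open>z\<close>, which looks like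
      \<open>x\<close>, so its increment is at least \<open>s\<close>. The step by \<open>w\<close>
      contributes less than \<open>s + \<epsilon>\<close>, so not much less than 0 was gained on the
      way to \<open>y\<close>.\<close>
    then have "y + w \<in> Y"
      using z(1) agree_on_trans unfolding Y_def w_def by fastforce
    then have "s \<le> h (y + w) - h x"
      unfolding s_def by (intro cInf_lower bdd) blast
    moreover have "h (x + w) - h x = h (y + w) - h y"
      by (rule pattern_equivariant_increment[OF pe der y]) (simp add: K_def)
    ultimately show ?thesis using z(2) by (simp add: w_def)
  qed
  then show ?thesis using that by blast
qed

section \<open>Uniqueness of the rotation class\<close>

text \<open>Primitives replace the signed integrals, so that concatenating return paths becomes
  addition of differences.\<close>

lemma rotation_form_between:
  assumes rot: "rotation_form F T \<mu>" and der: "\<And>x. (h has_real_derivative \<mu> x) (at x)"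
  shows "\<exists>R>0. \<forall>x y m n. agree_on {- R..R} (shift x T) (shift y T) \<longrightarrow>
      of_int m < h y - h x \<longrightarrow> h y - h x < of_int n \<longrightarrow>
      strictly_between (int_iterate (orbit_map F T) m x) y (int_iterate (orbit_map F T) n x)"
proof -
  have "continuous_on UNIV \<mu>" using rot by (simp add: rotation_form_def sPE_def)
  then have "(LBINT x=a..b. \<mu> x) = h b - h a" for a b :: real
    by (rule interval_integral_eq_diff[OF _ der])
  then show ?thesis using rot unfolding rotation_form_def by (simp add: imp_conjL)
qed

text \<open>If the two increments differed along a return path, finer returns to its end would
  preserve most of the difference, while irrationality would bring the increment of \<open>h\<close>
  just above an integer. That integer would then separate the two increments.\<close>

lemma returns_have_equal_increments:
  assumes T: "tiling T" and min: "irrational_class T \<mu>"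
    and pe: "pattern_equivariant T r (\<lambda>x. \<mu> x - \<nu> x)"
    and h: "\<And>x. (h has_real_derivative \<mu> x) (at x)" and k: "\<And>x. (k has_real_derivative \<nu> x) (at x)"
    and no_int: "\<And>x y n. agree_on {- R..R} (shift x T) (shift y T) \<Longrightarrow>
      \<not> (h y - h x < of_int n \<and> of_int n < k y - k x) \<and> \<not> (k y - k x < of_int n \<and> of_int n < h y - h x)"
    and xy: "agree_on {- R..R} (shift x T) (shift y T)"
  shows "h y - k y = h x - k x"
proof -
  define g where "g x = h x - k x" for x
  have g: "(g has_real_derivative (\<mu> x - \<nu> x)) (at x)" for x
    unfolding g_def by (intro DERIV_diff h k)
  have bound: "\<bar>g v - g u\<bar> \<le> 1" if "agree_on {- R..R} (shift u T) (shift v T)" for u v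
  proof (rule ccontr)
    assume "\<not> ?thesis"
    then have "h v - h u + 1 < k v - k u \<or> k v - k u + 1 < h v - h u"
      unfolding g_def by linarith
    \<comment> \<open>The least integer above the smaller increment is still below the larger one
      when they differ by more than 1.\<close>
    then show False
      using no_int[OF that, of "\<lfloor>h v - h u\<rfloor> + 1"] no_int[OF that, of "\<lfloor>k v - k u\<rfloor> + 1"] by linarith
  qed
  obtain \<mu>' R' where coh: "cohomologous T \<mu>' \<mu>" and R': "0 < R'" "pattern_equivariant T R' \<mu>'"
      and sgn: "(\<forall>x. 0 < \<mu>' x) \<or> (\<forall>x. \<mu>' x < 0)"
      and min: "minimal_under_unit_shift (shape_change T R' \<mu>')"
    using min unfolding irrational_class_def by blast
  obtain \<gamma> where "sPE T \<gamma>" and \<gamma>: "\<And>x. (\<gamma> has_real_derivative (\<mu>' x - \<mu> x)) (at x)"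
    using coh unfolding cohomologous_def by blast
  then obtain R\<gamma> where R\<gamma>: "0 < R\<gamma>" "pattern_equivariant T R\<gamma> \<gamma>" unfolding sPE_def by blast
  define c where "c = h 0 + \<gamma> 0"
  \<comment> \<open>Since \<open>\<mu>'\<close> is \<open>\<mu>\<close> plus the derivative of
    \<open>\<gamma>\<close>, this is its primitive, normalised by \<open>c\<close> to vanish at
    0.\<close>
  define m where "m x = h x + \<gamma> x - c" for x
  interpret change: shape_changing_form T R' \<mu>' m
  proof
    show "continuous_on UNIV \<mu>'" using coh by (simp add: cohomologous_def sPE_def)
    show "(m has_real_derivative \<mu>' x) (at x)" for x
      using DERIV_diff[OF DERIV_add[OF h \<gamma>] DERIV_const[of c], of x] by (simp add: m_def[abs_def])
  qed (use T R' sgn in \<open>auto simp: m_def c_def\<close>)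
  text \<open>If \<open>g\<close> increases from \<open>u\<close> to \<open>v\<close>, minimality provides a return near \<open>v\<close> at which the
    integral of the first form lies just above an integer; that of the second is then below it.\<close>
  have no_increase: "\<not> g u < g v" if uv: "agree_on {- R..R} (shift u T) (shift v T)" for u v
  proof
    assume "g u < g v"
    define \<delta> where "\<delta> = g v - g u"
    have \<delta>: "0 < \<delta>" using \<open>g u < g v\<close> by (simp add: \<delta>_def)
    obtain K where K: "\<And>y. agree_on {- K..K} (shift v T) (shift y T) \<Longrightarrow> - (\<delta> / 4) \<le> g y - g v"
      by (rule return_increment_lower_bound[where x = v and R = R and \<epsilon> = "\<delta> / 4", OF pe g bound])
        (use \<delta> in auto)
    \<comment> \<open>Three demands on the return \<open>y\<close> of \<open>v\<close>:
      \<open>K\<close> limits the loss of \<open>g\<close>, \<open>R\<close> makes the composite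
      path from \<open>u\<close> a return path, and \<open>R\<gamma>\<close> keeps the value of
      \<open>\<gamma>\<close>.\<close>
    define rad where "rad = max (max K R) R\<gamma>"
    have "0 < \<delta> / 8" "0 \<le> rad" using \<delta> R\<gamma>(1) by (auto simp: rad_def le_max_iff_disj)
    \<comment> \<open>The target is chosen so that, once \<open>\<gamma> y = \<gamma> v\<close>, it
      says that \<open>h y - h u\<close> is within \<open>\<delta> / 8\<close> of
      \<open>n + \<delta> / 4\<close>.\<close>
    then obtain y n where y: "agree_on {- rad..rad} (shift v T) (shift y T)"
        and n: "\<bar>m y - (of_int n + (\<delta> / 4 + h u + \<gamma> v - c))\<bar> \<le> \<delta> / 8"
      by (rule change.return_dense[OF min])
    have "agree_on {- R\<gamma>..R\<gamma>} (shift v T) (shift y T)"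
      by (rule agree_on_radius_mono[OF y]) (simp add: rad_def)
    then have "\<gamma> v = \<gamma> y" using R\<gamma>(2) unfolding pattern_equivariant_def by blast
    then have hy: "\<bar>h y - h u - of_int n - \<delta> / 4\<bar> \<le> \<delta> / 8" using n by (simp add: m_def algebra_simps)
    have "agree_on {- K..K} (shift v T) (shift y T)"
      by (rule agree_on_radius_mono[OF y]) (simp add: rad_def)
    then have "- (\<delta> / 4) \<le> g y - g v" by (rule K)
    then have gy: "3 * \<delta> / 4 \<le> g y - g u" by (simp add: \<delta>_def field_simps)
    have "agree_on {- R..R} (shift v T) (shift y T)"
      by (rule agree_on_radius_mono[OF y]) (simp add: rad_def)
    with uv have "agree_on {- R..R} (shift u T) (shift y T)" by (rule agree_on_trans)
    \<comment> \<open>The increment of \<open>h\<close> exceeds \<open>n\<close> by at least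
      \<open>\<delta> / 8\<close> and at most \<open>3 * \<delta> / 8\<close>; that of
      \<open>g\<close> is at least \<open>3 * \<delta> / 4\<close>, which pushes the increment of
      \<open>k\<close> below \<open>n\<close>.\<close>
    moreover have "of_int n < h y - h u" "k y - k u < of_int n"
      using hy gy \<delta> unfolding g_def by linarith+
    ultimately show False using no_int by blast
  qed
  \<comment> \<open>Being a return is symmetric, so excluding an increase in both directions gives
    equality.\<close>
  have "agree_on {- R..R} (shift y T) (shift x T)" using xy by (simp add: agree_on_def)
  then have "g y = g x" using no_increase[of x y] no_increase[of y x] xy by force
  then show ?thesis by (simp add: g_def)
qed

theorem theorem2:
  fixes \<Omega> :: "'l tile set set" and T :: "'l tile set"
    and F :: "'l tile set \<Rightarrow> 'l tile set" and \<mu> \<nu> :: "real \<Rightarrow> real"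
  assumes "tiling_space \<Omega>" and "uniquely_ergodic \<Omega>"
    and "T \<in> \<Omega>"
    and "F \<in> displacement_homeos \<Omega>"
    and "rotation_form F T \<mu>" and "rotation_form F T \<nu>"
    and "irrational_class T \<mu>"
  shows "cohomologous T \<mu> \<nu>"
proof -
  obtain T0 where T0: "tiling T0" "repetitive T0" "nonperiodic T0" "\<Omega> = orbit_closure T0"
    using assms(1) unfolding tiling_space_def by blast
  have T: "tiling T" using assms(3) unfolding T0(4) mem_orbit_closure_iff[OF T0(1)] by blast
  have np: "nonperiodic T"
    using nonperiodic_orbit_closure[OF T0(1-3)] assms(3) unfolding T0(4) by blast
  have \<Omega>: "shift x T \<in> \<Omega>" for x
    using orbit_closure_shift[OF T0(1)] assms(3) unfolding T0(4) by blast
  define f where "f = orbit_map F T"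
  have cont: "continuous_on UNIV f"
    unfolding f_def by (rule continuous_orbit_map[OF T np \<Omega> assms(4)])
  have \<mu>: "sPE T \<mu>" and \<nu>: "sPE T \<nu>" using assms(5,6) by (simp_all add: rotation_form_def)
  obtain r1 r2 where r: "pattern_equivariant T r1 \<mu>" "pattern_equivariant T r2 \<nu>"
    using \<mu> \<nu> unfolding sPE_def by blast
  obtain h where h: "\<And>x. (h has_real_derivative \<mu> x) (at x)"
    using antiderivative_exists \<mu> unfolding sPE_def by blast
  obtain k where k: "\<And>x. (k has_real_derivative \<nu> x) (at x)"
    using antiderivative_exists \<nu> unfolding sPE_def by blast
  obtain R1 where R1: "0 < R1" "\<forall>x y m n. agree_on {- R1..R1} (shift x T) (shift y T) \<longrightarrow>
      of_int m < h y - h x \<longrightarrow> h y - h x < of_int n \<longrightarrow>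
      strictly_between (int_iterate f m x) y (int_iterate f n x)"
    using rotation_form_between[OF assms(5) h, folded f_def] by (elim exE conjE) (rule that)
  obtain R2 where R2: "0 < R2" "\<forall>x y m n. agree_on {- R2..R2} (shift x T) (shift y T) \<longrightarrow>
      of_int m < k y - k x \<longrightarrow> k y - k x < of_int n \<longrightarrow>
      strictly_between (int_iterate f m x) y (int_iterate f n x)"
    using rotation_form_between[OF assms(6) k, folded f_def] by (elim exE conjE) (rule that)
  define R where "R = max R1 R2"
  have mono: "(\<forall>x m n. m < n \<longrightarrow> int_iterate f m x < int_iterate f n x) \<or>
         (\<forall>x m n. m < n \<longrightarrow> int_iterate f n x < int_iterate f m x)"
  proof (rule int_iterate_monotone[OF cont])
    \<comment> \<open>Equal base points agree to every radius and have increment 0, which lies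
      strictly between the integers -1 and 1.\<close>
    show "strictly_between (int_iterate f (- 1) x) x (int_iterate f 1 x)" for x
      by (rule R1(2)[rule_format]) (simp_all add: agree_on_def)
  qed
  have no_int: "\<not> (h y - h x < of_int n \<and> of_int n < k y - k x) \<and>
      \<not> (k y - k x < of_int n \<and> of_int n < h y - h x)"
    if xy: "agree_on {- R..R} (shift x T) (shift y T)" for x y n
  proof -
    have 1: "agree_on {- R1..R1} (shift x T) (shift y T)"
      by (rule agree_on_radius_mono[OF xy]) (simp add: R_def)
    have 2: "agree_on {- R2..R2} (shift x T) (shift y T)"
      by (rule agree_on_radius_mono[OF xy]) (simp add: R_def)
    show ?thesis
      using no_integer_between[OF mono R1(2)[rule_format, OF 1] R2(2)[rule_format, OF 2]]
        no_integer_between[OF mono R2(2)[rule_format, OF 2] R1(2)[rule_format, OF 1]] by blast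
  qed
  have pe: "pattern_equivariant T (max r1 r2) (\<lambda>x. \<mu> x - \<nu> x)"
    unfolding pattern_equivariant_def
  proof (intro allI impI)
    fix x y assume xy: "agree_on {- max r1 r2..max r1 r2} (shift x T) (shift y T)"
    have "agree_on {- r1..r1} (shift x T) (shift y T)" "agree_on {- r2..r2} (shift x T) (shift y T)"
      by (rule agree_on_radius_mono[OF xy], simp)+
    then show "\<mu> x - \<nu> x = \<mu> y - \<nu> y" using r unfolding pattern_equivariant_def by metis
  qed
  have der: "((\<lambda>x. h x - k x) has_real_derivative (\<mu> x - \<nu> x)) (at x)" for x
    by (intro DERIV_diff h k)
  \<comment> \<open>The primitive \<open>h x - k x\<close> of the difference is itself the sPE
    function that exhibits the forms as cohomologous.\<close>
  have "pattern_equivariant T R (\<lambda>x. h x - k x)"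
    unfolding pattern_equivariant_def
    using returns_have_equal_increments[OF T assms(7) pe h k no_int] by metis
  moreover have "continuous_on UNIV (\<lambda>x. h x - k x)"
    using der by (meson DERIV_continuous continuous_at_imp_continuous_on)
  moreover have "0 < R" using R1(1) by (simp add: R_def)
  ultimately have "sPE T (\<lambda>x. h x - k x)" unfolding sPE_def by blast
  then show ?thesis unfolding cohomologous_def using \<mu> \<nu> der by blast
qed

end
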